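(* Let $\mathcal K_{\mathbb B^4}(q,r)$ be the slice Bergman kernel of the second kind of the unit ball $\mathbb B^4=\{q\in\mathbb H:|q|<1\}$ and let $\mathcal K_{BF}(q,r):=\Delta\mathcal K_{\mathbb B^4}(q,r)$ be the Bergman-Fueter kernel, where $\Delta$ is the Laplace operator on $\mathbb H\cong\mathbb R^4$ in the variable $q$. Then $\mathcal K_{BF}(q,r)$ is (left) Fueter regular in $q\in\mathbb B^4$ and slice anti-regular on the right in $r\in\mathbb B^4$.
   Context: $\mathbb H$ is the algebra of real quaternions with units $\imath,\jmath,k$, $\mathbb S^2$ is the set of purely imaginary quaternions of modulus $1$, and for $\mathbf i\in\mathbb S^2$, $\mathbb C(\mathbf i)=\{x+y\mathbf i: x,y\in\mathbb R\}$. For $\Omega\subseteq\mathbb H$ put $\Omega_{\mathbf i}=\Omega\cap\mathbb C(\mathbf i)$. For $q=x_0+\imath x_1+\jmath x_2+kx_3$, $\Delta=\sum_{l=0}^3\partial_{x_l}^2$. A function $g$ on an open subset of $\mathbb H$ is (left) Fueter regular if $\partial_{x_0}g+\imath\,\partial_{x_1}g+\jmath\,\partial_{x_2}g+k\,\partial_{x_3}g=0$. A real differentiable $f:\Omega\to\mathbb H$ on an open set $\Omega$ is (left) slice regular, $f\in\mathcal{SR}(\Omega)$, if for every $\mathbf i\in\mathbb S^2$, $\frac{\partial f}{\partial x}(x+y\mathbf i)+\mathbf i\frac{\partial f}{\partial y}(x+y\mathbf i)=0$ on $\Omega_{\mathbf i}$. It is slice anti-regular on the right if for every $\mathbf i\in\mathbb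 S^2$, $\frac{\partial f}{\partial x}(x+y\mathbf i)-\frac{\partial f}{\partial y}(x+y\mathbf i)\,\mathbf i=0$ on $\Omega_{\mathbf i}$. Let $\Omega=\mathbb B^4$. For $\mathbf j\in\mathbb S^2$, $\mathcal A(\Omega_{\mathbf j})=\{f\in\mathcal{SR}(\Omega): \int_{\Omega_{\mathbf j}}|f|^2d\sigma_{\mathbf j}<\infty\}$, with $d\sigma_{\mathbf j}(x+\mathbf j y)=dx\,dy$, is a quaternionic right Hilbert space with inner product $\langle f,g\rangle=\int_{\Omega_{\mathbf j}}\overline f\,g\,d\sigma_{\mathbf j}$. For $q\in\Omega_{\mathbf j}$ there is a unique $K_q(\mathbf j)\in\mathcal A(\Omega_{\mathbf j})$ with $f(q)=\langle K_q(\mathbf j),f\rangle$ for all $f\in\mathcal A(\Omega_{\mathbf j})$. Put $\mathcal K_{\Omega_{\mathbf j}}(q,r)=\overline{K_q(\mathbf j)(r)}$, $q,r\in\Omega_{\mathbf j}$. The slice Bergman kernel of the second kind $\mathcal K_\Omega:\Omega\times\Omega\to\mathbb H$ is the extension in the first variable: for $r\in\Omega$, choose $\mathbf j\in\mathbb S^2$ with $r\in\Omega_{\mathbf j}$, and for $q=x+y\mathbf i\in\Omega$ ($x,y\in\mathbb R$, $\mathbf i\in\mathbb S^2$) put $$\mathcal K_\Omega(x+y\mathbf i,r)=\tfrac12(1-\mathbf i\mathbf j)\,\mathcal K_{\Omega_{\mathbf j}}(x+y\mathbf j,r)+\tfrac12(1+\mathbf i\mathbf j)\,\mathcal K_{\Omega_{\mathbf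 j}}(x-y\mathbf j,r).$$ *)

theory Defs
  imports "HOL-Analysis.Analysis"
begin

section \<open>The quaternions\<close>

codatatype quat = Quat (qRe: real) (qIm1: real) (qIm2: real) (qIm3: real)

lemma quat_eqI [intro?]:
  "\<lbrakk>qRe p = qRe q; qIm1 p = qIm1 q; qIm2 p = qIm2 q; qIm3 p = qIm3 q\<rbrakk> \<Longrightarrow> p = q"
  by (rule quat.expand) simp

lemma quat_eq_iff:
  "p = q \<longleftrightarrow> qRe p = qRe q \<and> qIm1 p = qIm1 q \<and> qIm2 p = qIm2 q \<and> qIm3 p = qIm3 q"
  by (auto intro: quat.expand)

subsection \<open>Algebra\<close>

instantiation quat :: ab_group_add
begin

primcorec zero_quat where
  "qRe 0 = 0" | "qIm1 0 = 0" | "qIm2 0 = 0" | "qIm3 0 = 0"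

primcorec plus_quat where
  "qRe (p + q) = qRe p + qRe q"
| "qIm1 (p + q) = qIm1 p + qIm1 q"
| "qIm2 (p + q) = qIm2 p + qIm2 q"
| "qIm3 (p + q) = qIm3 p + qIm3 q"

primcorec uminus_quat where
  "qRe (- q) = - qRe q"
| "qIm1 (- q) = - qIm1 q"
| "qIm2 (- q) = - qIm2 q"
| "qIm3 (- q) = - qIm3 q"

primcorec minus_quat where
  "qRe (p - q) = qRe p - qRe q"
| "qIm1 (p - q) = qIm1 p - qIm1 q"
| "qIm2 (p - q) = qIm2 p - qIm2 q"
| "qIm3 (p - q) = qIm3 p - qIm3 q"

instance
  by standard (simp_all add: quat_eq_iff)

end

instantiation quat :: ring_1
begin

primcorec one_quat where
  "qRe 1 = 1" | "qIm1 1 = 0" | "qIm2 1 = 0" | "qIm3 1 = 0"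

primcorec times_quat where
  "qRe (p * q) = qRe p * qRe q - qIm1 p * qIm1 q - qIm2 p * qIm2 q - qIm3 p * qIm3 q"
| "qIm1 (p * q) = qRe p * qIm1 q + qIm1 p * qRe q + qIm2 p * qIm3 q - qIm3 p * qIm2 q"
| "qIm2 (p * q) = qRe p * qIm2 q - qIm1 p * qIm3 q + qIm2 p * qRe q + qIm3 p * qIm1 q"
| "qIm3 (p * q) = qRe p * qIm3 q + qIm1 p * qIm2 q - qIm2 p * qIm1 q + qIm3 p * qRe q"

instance
  by standard (simp_all add: quat_eq_iff algebra_simps)

end

instantiation quat :: real_algebra_1
begin

primcorec scaleR_quat where
  "qRe (c *\<^sub>R q) = c * qRe q"
| "qIm1 (c *\<^sub>R q) = c * qIm1 q"
| "qIm2 (c *\<^sub>R q) = c * qIm2 q"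
| "qIm3 (c *\<^sub>R q) = c * qIm3 q"

instance
  by standard (simp_all add: quat_eq_iff algebra_simps)

end

lemma of_real_quat_sel [simp]:
  "qRe (of_real x) = x" "qIm1 (of_real x) = 0" "qIm2 (of_real x) = 0" "qIm3 (of_real x) = 0"
  by (simp_all add: of_real_def)

definition quat_ii :: quat where "quat_ii = Quat 0 1 0 0"
definition quat_jj :: quat where "quat_jj = Quat 0 0 1 0"
definition quat_kk :: quat where "quat_kk = Quat 0 0 0 1"

lemma quat_unit_sel [simp]:
  "qRe quat_ii = 0" "qIm1 quat_ii = 1" "qIm2 quat_ii = 0" "qIm3 quat_ii = 0"
  "qRe quat_jj = 0" "qIm1 quat_jj = 0" "qIm2 quat_jj = 1" "qIm3 quat_jj = 0"
  "qRe quat_kk = 0" "qIm1 quat_kk = 0" "qIm2 quat_kk = 0" "qIm3 quat_kk = 1"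
  by (simp_all add: quat_ii_def quat_jj_def quat_kk_def)

lemma quat_unit_mult:
  "quat_ii * quat_ii = - 1" "quat_jj * quat_jj = - 1" "quat_kk * quat_kk = - 1"
  "quat_ii * quat_jj = quat_kk" "quat_jj * quat_kk = quat_ii" "quat_kk * quat_ii = quat_jj"
  "quat_jj * quat_ii = - quat_kk" "quat_kk * quat_jj = - quat_ii" "quat_ii * quat_kk = - quat_jj"
  by (simp_all add: quat_eq_iff)

primcorec qcnj :: "quat \<Rightarrow> quat" where
  "qRe (qcnj q) = qRe q"
| "qIm1 (qcnj q) = - qIm1 q"
| "qIm2 (qcnj q) = - qIm2 q"
| "qIm3 (qcnj q) = - qIm3 q"

subsection \<open>Euclidean structure\<close>

instantiation quat :: real_inner
begin

definition inner_quat :: "quat \<Rightarrow> quat \<Rightarrow> real" where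
  "inner_quat p q = qRe p * qRe q + qIm1 p * qIm1 q + qIm2 p * qIm2 q + qIm3 p * qIm3 q"

definition norm_quat :: "quat \<Rightarrow> real" where
  "norm_quat q = sqrt (inner q q)"

definition sgn_quat :: "quat \<Rightarrow> quat" where
  "sgn_quat q = q /\<^sub>R norm q"

definition dist_quat :: "quat \<Rightarrow> quat \<Rightarrow> real" where
  "dist_quat p q = norm (p - q)"

definition uniformity_quat :: "(quat \<times> quat) filter" where
  "uniformity_quat = (INF e\<in>{0<..}. principal {(p, q). dist p q < e})"

definition open_quat :: "quat set \<Rightarrow> bool" where
  "open_quat U \<longleftrightarrow> (\<forall>p\<in>U. eventually (\<lambda>(p', q). p' = p \<longrightarrow> q \<in> U) uniformity)"

instance
proof
  fix p q r :: quat and c :: real and U :: "quat set"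
  show "dist p q = norm (p - q)" by (rule dist_quat_def)
  show "sgn q = q /\<^sub>R norm q" by (rule sgn_quat_def)
  show "uniformity = (INF e\<in>{0<..}. principal {(p :: quat, q). dist p q < e})"
    by (rule uniformity_quat_def)
  show "open U \<longleftrightarrow> (\<forall>p\<in>U. eventually (\<lambda>(p', q). p' = p \<longrightarrow> q \<in> U) uniformity)"
    by (rule open_quat_def)
  show "inner p q = inner q p" by (simp add: inner_quat_def mult.commute)
  show "inner (p + q) r = inner p r + inner q r" by (simp add: inner_quat_def algebra_simps)
  show "inner (c *\<^sub>R p) q = c * inner p q" by (simp add: inner_quat_def algebra_simps)
  show "0 \<le> inner p p" by (simp add: inner_quat_def)
  show "inner p p = 0 \<longleftrightarrow> p = 0"
  proof
    assume "inner p p = 0"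
    then have "qRe p ^ 2 + qIm1 p ^ 2 + qIm2 p ^ 2 + qIm3 p ^ 2 = 0"
      by (simp add: inner_quat_def power2_eq_square)
    then show "p = 0"
      by (simp add: quat_eq_iff add_nonneg_eq_0_iff)
  qed (simp add: inner_quat_def)
  show "norm p = sqrt (inner p p)" by (rule norm_quat_def)
qed

end

lemma norm_quat_eq: "norm q = sqrt (qRe q ^ 2 + qIm1 q ^ 2 + qIm2 q ^ 2 + qIm3 q ^ 2)"
  by (simp add: norm_quat_def inner_quat_def power2_eq_square)

lemma norm_quat_mult: "norm (p * q) = norm p * norm q" for p q :: quat
proof -
  have "(qRe (p * q))\<^sup>2 + (qIm1 (p * q))\<^sup>2 + (qIm2 (p * q))\<^sup>2 + (qIm3 (p * q))\<^sup>2 =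
    ((qRe p)\<^sup>2 + (qIm1 p)\<^sup>2 + (qIm2 p)\<^sup>2 + (qIm3 p)\<^sup>2) *
    ((qRe q)\<^sup>2 + (qIm1 q)\<^sup>2 + (qIm2 q)\<^sup>2 + (qIm3 q)\<^sup>2)"
    unfolding times_quat.sel by algebra
  then show ?thesis
    by (simp only: norm_quat_eq real_sqrt_mult)
qed

instance quat :: real_normed_algebra_1
proof
  fix p q :: quat
  show "norm (p * q) \<le> norm p * norm q"
    by (simp add: norm_quat_mult)
  show "norm (1 :: quat) = 1" by (simp add: norm_quat_eq)
qed

instantiation quat :: inverse
begin

definition inverse_quat :: "quat \<Rightarrow> quat" where
  "inverse_quat q = qcnj q /\<^sub>R (norm q)\<^sup>2"

definition divide_quat :: "quat \<Rightarrow> quat \<Rightarrow> quat" where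
  "divide_quat p q = p * inverse q"

instance ..

end

instance quat :: real_normed_div_algebra
proof
  fix p q :: quat
  have *: "q * qcnj q = of_real ((norm q)\<^sup>2)" "qcnj q * q = of_real ((norm q)\<^sup>2)"
    by (simp_all add: quat_eq_iff norm_quat_eq power2_eq_square)
  show "inverse q * q = 1" "q * inverse q = 1" if "q \<noteq> 0"
    using that by (simp_all only: inverse_quat_def mult_scaleR_left mult_scaleR_right *)
      (simp_all add: of_real_def)
  show "p / q = p * inverse q" by (rule divide_quat_def)
  show "inverse (0 :: quat) = 0" by (simp add: inverse_quat_def)
  show "norm (p * q) = norm p * norm q" by (rule norm_quat_mult)
qed

instantiation quat :: euclidean_space
begin

definition Basis_quat :: "quat set" where
  "Basis_quat = {1, quat_ii, quat_jj, quat_kk}"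

instance
proof
  fix u v x :: quat
  show "(Basis :: quat set) \<noteq> {}" "finite (Basis :: quat set)"
    by (simp_all add: Basis_quat_def)
  show "inner u v = (if u = v then 1 else 0)" if "u \<in> Basis" "v \<in> Basis"
    using that unfolding Basis_quat_def
    by (elim insertE emptyE; simp add: inner_quat_def quat_eq_iff)
  show "(\<forall>u\<in>Basis. inner x u = 0) \<longleftrightarrow> x = 0"
    by (simp add: Basis_quat_def inner_quat_def) (simp add: quat_eq_iff)
qed

end


section \<open>Slices, regularity and differential operators\<close>

abbreviation quat_ball :: "quat set" where
  "quat_ball \<equiv> ball 0 1"

definition imag_sphere :: "quat set" where
  "imag_sphere = {q. qRe q = 0 \<and> norm q = 1}"

definition slice_point :: "quat \<Rightarrow> real \<Rightarrow> real \<Rightarrow> quat" where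
  "slice_point i x y = of_real x + of_real y * i"

definition slice_plane :: "quat \<Rightarrow> quat set" where
  "slice_plane i = {slice_point i x y | x y. True}"

definition slice :: "quat set \<Rightarrow> quat \<Rightarrow> quat set" where
  "slice \<Omega> i = \<Omega> \<inter> slice_plane i"

definition slice_dx :: "(quat \<Rightarrow> quat) \<Rightarrow> quat \<Rightarrow> real \<Rightarrow> real \<Rightarrow> quat" where
  "slice_dx f i x y = vector_derivative (\<lambda>t. f (slice_point i t y)) (at x)"

definition slice_dy :: "(quat \<Rightarrow> quat) \<Rightarrow> quat \<Rightarrow> real \<Rightarrow> real \<Rightarrow> quat" where
  "slice_dy f i x y = vector_derivative (\<lambda>t. f (slice_point i x t)) (at y)"

definition slice_regular_on :: "quat set \<Rightarrow> (quat \<Rightarrow> quat) \<Rightarrow> bool" where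
  "slice_regular_on \<Omega> f \<longleftrightarrow> open \<Omega> \<and> f differentiable_on \<Omega> \<and>
     (\<forall>i\<in>imag_sphere. \<forall>x y. slice_point i x y \<in> \<Omega> \<longrightarrow>
        slice_dx f i x y + i * slice_dy f i x y = 0)"

definition slice_antiregular_right_on :: "quat set \<Rightarrow> (quat \<Rightarrow> quat) \<Rightarrow> bool" where
  "slice_antiregular_right_on \<Omega> f \<longleftrightarrow> open \<Omega> \<and> f differentiable_on \<Omega> \<and>
     (\<forall>i\<in>imag_sphere. \<forall>x y. slice_point i x y \<in> \<Omega> \<longrightarrow>
        slice_dx f i x y - slice_dy f i x y * i = 0)"

text \<open>For \<open>e\<close> equal to \<open>1\<close>, \<open>quat_ii\<close>, \<open>quat_jj\<close>, \<open>quat_kk\<close> this is the partial derivative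
  with respect to the real coordinate \<open>x\<^sub>0\<close>, \<open>x\<^sub>1\<close>, \<open>x\<^sub>2\<close>, \<open>x\<^sub>3\<close>.\<close>

definition qpartial :: "quat \<Rightarrow> (quat \<Rightarrow> quat) \<Rightarrow> quat \<Rightarrow> quat" where
  "qpartial e g q = vector_derivative (\<lambda>t. g (q + t *\<^sub>R e)) (at 0)"

definition fueter_regular_on :: "quat set \<Rightarrow> (quat \<Rightarrow> quat) \<Rightarrow> bool" where
  "fueter_regular_on U g \<longleftrightarrow> open U \<and> g differentiable_on U \<and>
     (\<forall>q\<in>U. qpartial 1 g q + quat_ii * qpartial quat_ii g q
           + quat_jj * qpartial quat_jj g q + quat_kk * qpartial quat_kk g q = 0)"

definition qlaplacian :: "(quat \<Rightarrow> quat) \<Rightarrow> quat \<Rightarrow> quat" where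
  "qlaplacian g q = qpartial 1 (qpartial 1 g) q + qpartial quat_ii (qpartial quat_ii g) q
     + qpartial quat_jj (qpartial quat_jj g) q + qpartial quat_kk (qpartial quat_kk g) q"


section \<open>Slice Bergman kernels\<close>

text \<open>The area measure \<open>dx dy\<close> on the plane \<open>slice_plane j\<close>, as a Borel measure on all
  quaternions that is concentrated on that plane.\<close>

definition slice_measure :: "quat \<Rightarrow> quat measure" where
  "slice_measure j = distr lborel borel (\<lambda>(x, y). slice_point j x y)"

text \<open>Functions are extensional on \<open>\<Omega>\<close> so that an element is determined by its values on
  \<open>\<Omega>\<close>; otherwise the reproducing element below would not be unique as a total function.\<close>

definition slice_bergman_space :: "quat set \<Rightarrow> quat \<Rightarrow> (quat \<Rightarrow> quat) set" where
  "slice_bergman_space \<Omega> j = {f \<in> extensional \<Omega>. slice_regular_on \<Omega> f \<and>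
     (\<integral>\<^sup>+ r\<in>slice \<Omega> j. ennreal ((norm (f r))\<^sup>2) \<partial>slice_measure j) < \<infinity>}"

definition slice_bergman_inner ::
  "quat set \<Rightarrow> quat \<Rightarrow> (quat \<Rightarrow> quat) \<Rightarrow> (quat \<Rightarrow> quat) \<Rightarrow> quat" where
  "slice_bergman_inner \<Omega> j f g = (LINT r:slice \<Omega> j|slice_measure j. qcnj (f r) * g r)"

definition slice_bergman_repr :: "quat set \<Rightarrow> quat \<Rightarrow> quat \<Rightarrow> (quat \<Rightarrow> quat)" where
  "slice_bergman_repr \<Omega> j q = (THE K. K \<in> slice_bergman_space \<Omega> j \<and>
     (\<forall>f\<in>slice_bergman_space \<Omega> j. f q = slice_bergman_inner \<Omega> j K f))"

definition bergman_kernel_on_slice :: "quat set \<Rightarrow> quat \<Rightarrow> quat \<Rightarrow> quat \<Rightarrow> quat" where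
  "bergman_kernel_on_slice \<Omega> j q r = qcnj (slice_bergman_repr \<Omega> j q r)"

definition bergman_kernel_extension ::
  "quat set \<Rightarrow> quat \<Rightarrow> quat \<Rightarrow> real \<Rightarrow> real \<Rightarrow> quat \<Rightarrow> quat" where
  "bergman_kernel_extension \<Omega> j i x y r =
     (1/2) *\<^sub>R ((1 - i * j) * bergman_kernel_on_slice \<Omega> j (slice_point j x y) r)
     + (1/2) *\<^sub>R ((1 + i * j) * bergman_kernel_on_slice \<Omega> j (slice_point j x (- y)) r)"

text \<open>The slice Bergman kernel of the second kind. The description operator expresses that the
  value depends neither on the unit \<open>j\<close> chosen with \<open>r\<close> in the slice of \<open>j\<close> (unique up to sign
  for non-real \<open>r\<close>, arbitrary for real \<open>r\<close>) nor on the representation \<open>q = x + y i\<close>.\<close>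

definition slice_bergman_kernel :: "quat set \<Rightarrow> quat \<Rightarrow> quat \<Rightarrow> quat" where
  "slice_bergman_kernel \<Omega> q r = (THE k. \<forall>j\<in>imag_sphere. r \<in> slice \<Omega> j \<longrightarrow>
     (\<forall>i\<in>imag_sphere. \<forall>x y. q = slice_point i x y \<longrightarrow>
        k = bergman_kernel_extension \<Omega> j i x y r))"

definition bergman_fueter_kernel :: "quat \<Rightarrow> quat \<Rightarrow> quat" where
  "bergman_fueter_kernel q r = qlaplacian (\<lambda>p. slice_bergman_kernel quat_ball p r) q"

end

theory Submission
  imports Defs "HOL-Complex_Analysis.Complex_Analysis" "HOL-Real_Asymp.Real_Asymp"
begin

text \<open>On a slice the representing element is the conjugate of the Bergman kernel of the unit disc,
  \<open>1 / (pi (1 - z w)\<^sup>2)\<close> with \<open>w\<close> the conjugate of the second variable. Its extension in \<open>q\<close> has the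
  form \<open>A + conj(q) B\<close>, where \<open>A\<close> and \<open>B\<close> are rational functions of \<open>p = conj(r)\<close> whose coefficients
  are polynomials in the real numbers \<open>x = Re q\<close> and \<open>s = |q|\<^sup>2\<close>. For functions of this form the
  Laplacian and the Fueter operator become differential operators in \<open>(x, s)\<close>, so that Fueter
  regularity reduces to the two identities \<open>A\<^sub>x + 4 x A\<^sub>s + 4 B + 2 s B\<^sub>s = 0\<close> and \<open>B\<^sub>x = 2 A\<^sub>s\<close>
  between complex rational functions. In \<open>r\<close> the kernel is a combination, with \<open>1\<close> and \<open>conj(q)\<close> on
  the left, of holomorphic functions with real coefficients evaluated at \<open>conj(r)\<close>.\<close>

section \<open>The Bergman kernel of the unit disc\<close>

text \<open>The kernel is specified by definite descriptions, so the closed form must first be shown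
  to be the only representing element. This takes the reproducing property of the disc kernel,
  obtained here from the moments of the disc, and a passage from quaternion-valued to holomorphic
  functions: a left C(j)-linear projection onto C(j), applied after right multiplication by an
  arbitrary constant, makes slice regular functions holomorphic, and together these projections
  separate quaternions. The obstacle in the differential part is noncommutativity. The relation
  conj(q)^2 = 2 x conj(q) - s lowers every power of conj(q) to a linear expression, so conj(q)
  survives as a single left factor, and A and B can be computed in one copy of the complex numbers.
  There the inverse V of the denominator D is treated as one more variable subject to V D = 1, which
  turns identities between rational functions into polynomial identities modulo this
  relation.\<close>

text \<open>Gives access to Fubini in the two real coordinates for complex integrals, and later
  relates \<open>slice_measure\<close> to the complex plane.\<close>

lemma lborel_complex_eq_distr:
  "(lborel :: complex measure) = distr lborel borel (\<lambda>(x, y). Complex x y)"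
proof (rule lborel_eqI)
  fix l u :: complex
  assume le: "\<And>b. b \<in> Basis \<Longrightarrow> l \<bullet> b \<le> u \<bullet> b"
  have "(\<lambda>(x, y). Complex x y) -` box l u \<inter> space lborel = box (Re l) (Re u) \<times> box (Im l) (Im u)"
    by (auto simp: box_complex_eq)
  moreover have m: "(\<lambda>(x, y). Complex x y) \<in> borel_measurable (lborel :: (real \<times> real) measure)"
    by (simp add: borel_measurable_continuous_onI case_prod_unfold Complex_eq continuous_intros)
  ultimately have "emeasure (distr lborel borel (\<lambda>(x, y). Complex x y)) (box l u) =
      emeasure (lborel \<Otimes>\<^sub>M lborel) (box (Re l) (Re u) \<times> box (Im l) (Im u))"
    by (simp add: emeasure_distr lborel_prod)
  also have "\<dots> = emeasure lborel (box (Re l) (Re u)) * emeasure lborel (box (Im l) (Im u))"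
    by (intro lborel.emeasure_pair_measure_Times) auto
  also have "\<dots> = (\<Prod>b\<in>Basis. (u - l) \<bullet> b)"
    using le[of 1] le[of \<i>] by (simp add: Basis_complex_def ennreal_mult'' complex_i_not_one)
  finally show "emeasure (distr lborel borel (\<lambda>(x, y). Complex x y)) (box l u) =
      (\<Prod>b\<in>Basis. (u - l) \<bullet> b)" .
qed simp

text \<open>For each fixed second coordinate the shear is a translation of the first one, so Fubini
  reduces the claim to translation invariance on the line.\<close>

lemma lborel_distr_shear_fst:
  fixes a :: real
  shows "distr lborel borel (\<lambda>(x, y). (x + a * y, y)) = (lborel :: (real \<times> real) measure)"
proof (rule measure_eqI)
  fix A assume "A \<in> sets (distr lborel borel (\<lambda>(x, y). (x + a * y, y :: real)))"
  then have A [measurable]: "A \<in> sets borel" by simp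
  have [measurable]: "(\<lambda>(x, y). (x + a * y, y)) \<in> borel_measurable (borel :: (real \<times> real) measure)"
    by (simp add: borel_measurable_continuous_onI case_prod_unfold continuous_intros)
  have "emeasure (distr lborel borel (\<lambda>(x, y). (x + a * y, y))) A =
    (\<integral>\<^sup>+ p. indicator A p \<partial>distr lborel borel (\<lambda>(x, y). (x + a * y, y)))"
    by simp
  also have "\<dots> = (\<integral>\<^sup>+ p. indicator A (case p of (x, y) \<Rightarrow> (x + a * y, y)) \<partial>(lborel \<Otimes>\<^sub>M lborel))"
    by (subst nn_integral_distr) (simp_all add: lborel_prod)
  also have "\<dots> = (\<integral>\<^sup>+ y. \<integral>\<^sup>+ x. indicator A (x + a * y, y) \<partial>lborel \<partial>lborel)"
    by (subst lborel_pair.nn_integral_snd[symmetric]) (simp_all add: lborel_prod)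
  also have "\<dots> = (\<integral>\<^sup>+ y. \<integral>\<^sup>+ x. indicator A (x, y) \<partial>lborel \<partial>lborel)"
  proof (rule nn_integral_cong)
    fix y
    show "(\<integral>\<^sup>+ x. indicator A (x + a * y, y) \<partial>lborel) = (\<integral>\<^sup>+ x. indicator A (x, y) \<partial>(lborel :: real measure))"
      using nn_integral_real_affine[of "\<lambda>x. indicator A (x, y)" 1 "a * y"]
      by (simp add: add.commute)
  qed
  also have "\<dots> = (\<integral>\<^sup>+ p. indicator A p \<partial>(lborel \<Otimes>\<^sub>M lborel))"
    by (subst lborel_pair.nn_integral_snd) (simp_all add: lborel_prod)
  finally show "emeasure (distr lborel borel (\<lambda>(x, y). (x + a * y, y))) A = emeasure lborel A"
    by (simp add: lborel_prod)
qed simp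

lemma lborel_distr_shear_snd:
  fixes a :: real
  shows "distr lborel borel (\<lambda>(x, y). (x, y + a * x)) = (lborel :: (real \<times> real) measure)"
proof (rule measure_eqI)
  fix A assume "A \<in> sets (distr lborel borel (\<lambda>(x, y). (x :: real, y + a * x)))"
  then have A [measurable]: "A \<in> sets borel" by simp
  have [measurable]: "(\<lambda>(x, y). (x, y + a * x)) \<in> borel_measurable (borel :: (real \<times> real) measure)"
    by (simp add: borel_measurable_continuous_onI case_prod_unfold continuous_intros)
  have "emeasure (distr lborel borel (\<lambda>(x, y). (x, y + a * x))) A =
    (\<integral>\<^sup>+ p. indicator A p \<partial>distr lborel borel (\<lambda>(x, y). (x, y + a * x)))"
    by simp
  also have "\<dots> = (\<integral>\<^sup>+ p. indicator A (case p of (x, y) \<Rightarrow> (x, y + a * x)) \<partial>(lborel \<Otimes>\<^sub>M lborel))"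
    by (subst nn_integral_distr) (simp_all add: lborel_prod)
  also have "\<dots> = (\<integral>\<^sup>+ x. \<integral>\<^sup>+ y. indicator A (x, y + a * x) \<partial>lborel \<partial>lborel)"
    by (subst lborel.nn_integral_fst[symmetric]) (simp_all add: lborel_prod)
  also have "\<dots> = (\<integral>\<^sup>+ x. \<integral>\<^sup>+ y. indicator A (x, y) \<partial>lborel \<partial>lborel)"
  proof (rule nn_integral_cong)
    fix x
    show "(\<integral>\<^sup>+ y. indicator A (x, y + a * x) \<partial>lborel) = (\<integral>\<^sup>+ y. indicator A (x, y) \<partial>(lborel :: real measure))"
      using nn_integral_real_affine[of "\<lambda>y. indicator A (x, y)" 1 "a * x"]
      by (simp add: add.commute)
  qed
  also have "\<dots> = (\<integral>\<^sup>+ p. indicator A p \<partial>(lborel \<Otimes>\<^sub>M lborel))"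
    by (subst lborel.nn_integral_fst) (simp_all add: lborel_prod)
  finally show "emeasure (distr lborel borel (\<lambda>(x, y). (x, y + a * x))) A = emeasure lborel A"
    by (simp add: lborel_prod)
qed simp

text \<open>A rotation of the plane is a product of three shears.\<close>

lemma lborel_distr_rotation:
  fixes c :: complex
  assumes c: "norm c = 1" and "Im c \<noteq> 0"
  shows "distr lborel borel (\<lambda>w. c * w) = (lborel :: complex measure)"
proof -
  \<comment> \<open>For c = cos t + i sin t this is - tan (t/2), the classical parameter of the two
    outer shears; the middle shear has parameter sin t. The division is the reason for assuming a
    nonreal c.\<close>
  define a where "a = (Re c - 1) / Im c"
  define S where "S = (\<lambda>(x, y). (x + a * y, y :: real))"
  define T where "T = (\<lambda>(x, y). (x :: real, y + Im c * x))"
  let ?C = "\<lambda>(x, y). Complex x y"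
  have nc: "(Re c)\<^sup>2 + (Im c)\<^sup>2 = 1"
    using c by (simp add: cmod_def)
  have as: "a * Im c = Re c - 1"
    using assms by (simp add: a_def)
  have aR: "a * (1 + Re c) = - Im c"
    using nc \<open>Im c \<noteq> 0\<close> by (simp add: a_def field_simps power2_eq_square)
  have [measurable]: "S \<in> borel_measurable borel" "T \<in> borel_measurable borel"
      "?C \<in> borel_measurable borel"
    by (simp_all add: S_def T_def borel_measurable_continuous_onI case_prod_unfold Complex_eq
        continuous_intros)
  have ST: "c * ?C v = ?C (S (T (S v)))" for v
  proof (cases v)
    case (Pair x y)
    have 1: "Im c * x + Re c * y = y + Im c * (x + a * y)"
      using as by (simp add: algebra_simps) (metis (no_types, opaque_lifting) diff_add_cancel mult.commute mult.left_commute distrib_left mult.right_neutral)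
    have "x + a * y + a * (y + Im c * (x + a * y)) = x + a * y + a * (Im c * x + Re c * y)"
      by (simp only: 1)
    also have "\<dots> = x + (a * Im c) * x + (a * (1 + Re c)) * y"
      by (simp add: algebra_simps)
    also have "\<dots> = Re c * x - Im c * y"
      unfolding as aR by (simp add: algebra_simps)
    finally show ?thesis
      using 1 by (simp add: Pair S_def T_def complex_eq_iff)
  qed
  have "distr lborel borel (\<lambda>w. c * w) = distr (distr lborel borel ?C) borel (\<lambda>w. c * w)"
    by (simp flip: lborel_complex_eq_distr)
  also have "\<dots> = distr lborel borel (\<lambda>v. ?C (S (T (S v))))"
    by (subst distr_distr) (simp_all add: comp_def ST)
  also have "\<dots> = distr (distr (distr (distr lborel borel S) borel T) borel S) borel ?C"
    by (simp add: distr_distr comp_def)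
  also have "\<dots> = lborel"
    unfolding S_def T_def lborel_distr_shear_fst lborel_distr_shear_snd
    by (simp flip: lborel_complex_eq_distr)
  finally show ?thesis .
qed

section \<open>Moments of a disc\<close>

text \<open>Rotating by c leaves the integral unchanged but multiplies the integrand by c^n
  conj(c)^m. As soon as this factor differs from 1, the integral vanishes.\<close>

lemma disc_monomials_orthogonal:
  assumes "n \<noteq> m"
  shows "(LINT w:ball 0 \<rho>|lborel. w ^ n * cnj w ^ m) = 0"
proof -
  define d where "d = max n m - min n m"
  have d: "d > 0" using assms by (auto simp: d_def)
  \<comment> \<open>Chosen so that c^d is the imaginary unit: the factor c^n conj(c)^m is then i or
    -i. Since d is positive, the angle lies strictly between 0 and pi, as a nonreal rotation
    requires.\<close>
  define c where "c = cis (pi / (2 * real d))"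
  have "0 < pi / (2 * real d)" "pi / (2 * real d) < pi"
    using d pi_gt_zero by (simp_all add: field_simps) 
  then have Im: "Im c \<noteq> 0"
    using sin_gt_zero[of "pi / (2 * real d)"] by (simp add: c_def)
  have nc: "norm c = 1" by (simp add: c_def)
  have cc: "c * cnj c = 1"
    using nc by (simp flip: complex_norm_square)
  have cd: "c ^ d = \<i>"
    unfolding c_def Complex.DeMoivre using d by simp
  have ne: "c ^ n * cnj c ^ m \<noteq> 1"
  proof (cases "n < m")
    case True
    then have "cnj c ^ m = cnj c ^ n * cnj c ^ d"
      by (simp add: d_def flip: power_add)
    then have "c ^ n * cnj c ^ m = (c * cnj c) ^ n * cnj (c ^ d)"
      by (simp add: power_mult_distrib)
    then show ?thesis by (simp add: cc cd complex_eq_iff)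
  next
    case False
    then have "c ^ n = c ^ d * c ^ m"
      by (simp add: d_def flip: power_add)
    then have "c ^ n * cnj c ^ m = c ^ d * (c * cnj c) ^ m"
      by (simp add: power_mult_distrib)
    then show ?thesis by (simp add: cc cd complex_eq_iff)
  qed
  let ?g = "\<lambda>w. indicator (ball 0 \<rho>) w *\<^sub>R (w ^ n * cnj w ^ m) :: complex"
  have ind: "indicator (ball 0 \<rho>) (c * w) = (indicator (ball 0 \<rho>) w :: real)" for w
    by (simp add: indicator_def norm_mult nc)
  have [measurable]: "?g \<in> borel_measurable borel" by (intro borel_measurable_scaleR borel_measurable_indicator borel_measurable_continuous_onI continuous_intros) auto
  have "integral\<^sup>L lborel ?g = integral\<^sup>L (distr lborel borel (\<lambda>w. c * w)) ?g"
    using lborel_distr_rotation[OF nc Im] by simp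
  also have "\<dots> = (LINT w|lborel. ?g (c * w))"
    by (rule integral_distr) auto
  also have "\<dots> = (LINT w|lborel. (c ^ n * cnj c ^ m) * ?g w)"
    unfolding ind by (simp add: power_mult_distrib mult_ac)
  also have "\<dots> = (c ^ n * cnj c ^ m) * integral\<^sup>L lborel ?g"
    by (rule integral_mult_right_zero)
  finally have "(1 - c ^ n * cnj c ^ m) * integral\<^sup>L lborel ?g = 0"
    by (simp add: algebra_simps)
  then show ?thesis
    using ne by (simp add: set_lebesgue_integral_def)
qed

lemma emeasure_complex_ball: "0 \<le> \<rho> \<Longrightarrow> emeasure lborel (ball (0::complex) \<rho>) = ennreal (pi * \<rho>\<^sup>2)"
  by (simp add: emeasure_ball unit_ball_vol_2)

text \<open>A substitute for polar coordinates. The difference rho^(k+1) - |w|^(k+1) is the integral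
  of (k+1) t^k over t from |w| to rho; after exchanging the integrals the inner one is the area pi
  t^2 of a disc, and only a power of t remains to be integrated.\<close>

lemma disc_radial_defect:
  assumes \<rho>: "0 \<le> \<rho>"
  shows "has_bochner_integral lborel (\<lambda>w :: complex. indicator (ball 0 \<rho>) w * (\<rho> ^ Suc k - norm w ^ Suc k))
           (real (Suc k) * pi * \<rho> ^ (k + 3) / real (k + 3))"
proof (rule has_bochner_integral_nn_integral)
  have "{p :: real \<times> complex. norm (snd p) \<le> fst p \<and> fst p \<le> \<rho>} \<in> sets borel"
    by (intro borel_closed closed_Collect_conj closed_Collect_le continuous_intros)
  then have "indicator {p :: real \<times> complex. norm (snd p) \<le> fst p \<and> fst p \<le> \<rho>} \<in>
      (borel_measurable borel :: (_ \<Rightarrow> ennreal) set)"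
    by (rule borel_measurable_indicator)
  then have ind: "(\<lambda>p. indicator {p :: complex \<times> real. norm (fst p) \<le> snd p \<and> snd p \<le> \<rho>} (snd p, fst p)) \<in>
      (borel_measurable borel :: (_ \<Rightarrow> ennreal) set)"
    by (simp add: indicator_def[abs_def])
  have FTC: "(\<integral>\<^sup>+ t. ennreal (real (Suc m) * t ^ m) * indicator {a..b} t \<partial>lborel) =
      ennreal (b ^ Suc m - a ^ Suc m)" if "0 \<le> a" "a \<le> b" for a b :: real and m
  proof (rule nn_integral_FTC_Icc)
    show "((\<lambda>t. t ^ Suc m) has_real_derivative real (Suc m) * t ^ m) (at t)" for t
      by (auto intro!: derivative_eq_intros simp del: power_Suc)
  qed (use that in auto)
  let ?h = "\<lambda>w :: complex. \<lambda>t. ennreal (real (Suc k) * t ^ k) *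
      indicator {p. norm (fst p) \<le> snd p \<and> snd p \<le> \<rho>} (w, t)"
  have h: "(\<integral>\<^sup>+ t. ?h w t \<partial>lborel) =
      ennreal (indicator (ball 0 \<rho>) w * (\<rho> ^ Suc k - norm w ^ Suc k))" for w
  proof (cases "norm w \<le> \<rho>")
    case True
    have "(\<integral>\<^sup>+ t. ?h w t \<partial>lborel) =
        (\<integral>\<^sup>+ t. ennreal (real (Suc k) * t ^ k) * indicator {norm w..\<rho>} t \<partial>lborel)"
      by (intro nn_integral_cong) (auto simp: indicator_def)
    also have "\<dots> = ennreal (\<rho> ^ Suc k - norm w ^ Suc k)"
      using True by (intro FTC) auto
    \<comment> \<open>On the boundary circle the indicator of the open disc is 0, but there the
      difference of powers vanishes too.\<close>
    also have "\<dots> = ennreal (indicator (ball 0 \<rho>) w * (\<rho> ^ Suc k - norm w ^ Suc k))"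
      using True by (cases "norm w = \<rho>") (auto simp: indicator_def)
    finally show ?thesis .
  next
    case False
    then show ?thesis
      by (auto simp: indicator_def nn_integral_0_iff_AE)
  qed
  have "(\<integral>\<^sup>+ w. ennreal (indicator (ball 0 \<rho>) w * (\<rho> ^ Suc k - norm (w :: complex) ^ Suc k)) \<partial>lborel) =
      (\<integral>\<^sup>+ w. \<integral>\<^sup>+ t. ?h w t \<partial>lborel \<partial>lborel)"
    by (simp only: h)
  also have "\<dots> = (\<integral>\<^sup>+ t. \<integral>\<^sup>+ w. ?h w t \<partial>lborel \<partial>lborel)"
  proof (rule lborel_pair.Fubini')
    have "(\<lambda>p :: real \<times> complex. ?h (snd p) (fst p)) \<in> borel_measurable borel"
      by (intro borel_measurable_times_ennreal ind measurable_compose[OF _ measurable_ennreal]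
          borel_measurable_continuous_onI continuous_intros)
    then show "(\<lambda>(t, w). ?h w t) \<in> borel_measurable (lborel \<Otimes>\<^sub>M lborel)"
      by (simp add: lborel_prod case_prod_unfold del: of_nat_Suc)
  qed
  \<comment> \<open>The constant is split so that the integrand is the derivative of t^(k+3) and
    \<open>FTC\<close> applies once more, with k + 2 for m.\<close>
  also have "\<dots> = (\<integral>\<^sup>+ t. ennreal (real (Suc k) * pi / real (k + 3)) *
      (ennreal (real (Suc (k + 2)) * t ^ (k + 2)) * indicator {0..\<rho>} t) \<partial>lborel)"
  proof (rule nn_integral_cong)
    fix t :: real
    have "(\<integral>\<^sup>+ w. ?h w t \<partial>lborel) =
        (\<integral>\<^sup>+ w. (ennreal (real (Suc k) * t ^ k) * indicator {0..\<rho>} t) * indicator (cball (0 :: complex) t) w \<partial>lborel)"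
      by (intro nn_integral_cong) (auto simp: indicator_def dest: order_trans[OF norm_ge_zero])
    also have "\<dots> = (ennreal (real (Suc k) * t ^ k) * indicator {0..\<rho>} t) * emeasure lborel (cball (0 :: complex) t)"
      by (rule nn_integral_cmult_indicator) simp
    also have "\<dots> = ennreal (real (Suc k) * pi / real (k + 3)) *
      (ennreal (real (Suc (k + 2)) * t ^ (k + 2)) * indicator {0..\<rho>} t)"
    proof (cases "t \<in> {0..\<rho>}")
      case True
      then have "emeasure lborel (cball (0 :: complex) t) = ennreal (pi * t\<^sup>2)"
        by (simp add: emeasure_cball unit_ball_vol_2)
      moreover have "real (Suc k) * t ^ k * (pi * t\<^sup>2) =
          real (Suc k) * pi / real (k + 3) * (real (Suc (k + 2)) * t ^ (k + 2))"
        by (simp add: power_add divide_simps) (simp add: algebra_simps power2_eq_square)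
      ultimately show ?thesis
        using True by (simp only: indicator_simps mult_1_right) (simp flip: ennreal_mult)
    qed simp
    finally show "(\<integral>\<^sup>+ w. ?h w t \<partial>lborel) = ennreal (real (Suc k) * pi / real (k + 3)) *
      (ennreal (real (Suc (k + 2)) * t ^ (k + 2)) * indicator {0..\<rho>} t)" .
  qed
  also have "\<dots> = ennreal (real (Suc k) * pi / real (k + 3)) * ennreal (\<rho> ^ Suc (k + 2) - 0 ^ Suc (k + 2))"
    using \<rho> by (subst nn_integral_cmult) (simp, simp only: FTC)
  also have "\<dots> = ennreal (real (Suc k) * pi * \<rho> ^ (k + 3) / real (k + 3))"
    using \<rho> by (simp flip: ennreal_mult add: numeral_3_eq_3)
  finally show "(\<integral>\<^sup>+ w. ennreal (indicator (ball 0 \<rho>) (w :: complex) * (\<rho> ^ Suc k - norm w ^ Suc k)) \<partial>lborel) =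
    ennreal (real (Suc k) * pi * \<rho> ^ (k + 3) / real (k + 3))" .
qed (use \<rho> in \<open>auto simp: indicator_def simp del: power_Suc intro!: power_mono\<close>)

lemma integrable_bounded_on_disc:
  fixes f :: "complex \<Rightarrow> complex"
  assumes "continuous_on (ball 0 \<rho>) f" and "\<And>w. w \<in> ball 0 \<rho> \<Longrightarrow> norm (f w) \<le> B"
  shows "set_integrable lborel (ball 0 \<rho>) f"
  unfolding set_integrable_def
proof (rule integrableI_bounded_set[where A = "ball 0 \<rho>" and B = B])
  show "(\<lambda>w. indicator (ball 0 \<rho>) w *\<^sub>R f w) \<in> borel_measurable lborel"
    using borel_measurable_continuous_on_indicator[OF _ assms(1)] by simp
  show "emeasure lborel (ball (0::complex) \<rho>) < \<infinity>"
    using emeasure_lborel_ball_finite by auto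
qed (use assms(2) in \<open>auto simp: indicator_def\<close>)

text \<open>Here |w|^(2n) is rho^(2n) minus the defect computed in \<open>disc_radial_defect\<close>
  for k = 2n - 1, hence the separate case n = 0, which is just the area.\<close>

lemma disc_monomial_norm:
  assumes "0 \<le> \<rho>"
  shows "(LINT w:ball 0 \<rho>|lborel. w ^ n * cnj w ^ n) = of_real (pi * \<rho> ^ (2 * n + 2) / real (n + 1))"
proof -
  have vol: "has_bochner_integral lborel (indicator (ball (0 :: complex) \<rho>)) (pi * \<rho>\<^sup>2)"
    using assms has_bochner_integral_real_indicator[of "ball (0::complex) \<rho>" lborel]
    by (simp add: emeasure_complex_ball measure_def)
  have "has_bochner_integral lborel (\<lambda>w :: complex. indicator (ball 0 \<rho>) w * norm w ^ (2 * n))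
      (pi * \<rho> ^ (2 * n + 2) / real (n + 1))"
  proof (cases n)
    case 0
    then show ?thesis using vol by (simp add: power2_eq_square)
  next
    case (Suc m)
    have "has_bochner_integral lborel
      (\<lambda>w :: complex. \<rho> ^ (2 * n) * indicator (ball 0 \<rho>) w - indicator (ball 0 \<rho>) w * (\<rho> ^ Suc (2 * m + 1) - norm w ^ Suc (2 * m + 1)))
      (\<rho> ^ (2 * n) * (pi * \<rho>\<^sup>2) - real (Suc (2 * m + 1)) * pi * \<rho> ^ (2 * m + 1 + 3) / real (2 * m + 1 + 3))"
      by (intro has_bochner_integral_diff has_bochner_integral_mult_right vol disc_radial_defect assms)
    also have "(\<lambda>w :: complex. \<rho> ^ (2 * n) * indicator (ball 0 \<rho>) w - indicator (ball 0 \<rho>) w * (\<rho> ^ Suc (2 * m + 1) - norm w ^ Suc (2 * m + 1))) =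
        (\<lambda>w :: complex. indicator (ball 0 \<rho>) w * norm w ^ (2 * n))"
      by (simp add: fun_eq_iff Suc algebra_simps)
    also have "\<rho> ^ (2 * n) * (pi * \<rho>\<^sup>2) - real (Suc (2 * m + 1)) * pi * \<rho> ^ (2 * m + 1 + 3) / real (2 * m + 1 + 3) =
        pi * \<rho> ^ (2 * n + 2) / real (n + 1)"
      by (simp add: Suc field_simps power_add power2_eq_square power3_eq_cube eval_nat_numeral)
    finally show ?thesis .
  qed
  then have "integral\<^sup>L lborel (\<lambda>w :: complex. indicator (ball 0 \<rho>) w * norm w ^ (2 * n)) =
      pi * \<rho> ^ (2 * n + 2) / real (n + 1)"
    by (rule has_bochner_integral_integral_eq)
  moreover have "indicator (ball 0 \<rho>) w *\<^sub>R (w ^ n * cnj w ^ n) =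
      of_real (indicator (ball 0 \<rho>) w * norm w ^ (2 * n))" for w :: complex
  proof -
    have "w ^ n * cnj w ^ n = (of_real (norm w))\<^sup>2 ^ n"
      by (simp only: power_mult_distrib[symmetric] complex_norm_square[symmetric] of_real_power)
    then show ?thesis
      by (simp add: scaleR_conv_of_real power_mult)
  qed
  ultimately show ?thesis
    by (simp only: set_lebesgue_integral_def integral_complex_of_real)
qed

section \<open>The reproducing property on the disc\<close>

text \<open>Constant bounds with a finite sum suffice for exchanging sum and integral, because the
  disc has finite area.\<close>

lemma disc_integral_sums:
  fixes g :: "nat \<Rightarrow> complex \<Rightarrow> complex"
  assumes "\<And>n. continuous_on (ball 0 \<rho>) (g n)"
    and le: "\<And>n w. w \<in> ball 0 \<rho> \<Longrightarrow> norm (g n w) \<le> M n"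
    and "summable M"
    and sums: "\<And>w. w \<in> ball 0 \<rho> \<Longrightarrow> (\<lambda>n. g n w) sums h w"
  shows "(\<lambda>n. LINT w:ball 0 \<rho>|lborel. g n w) sums (LINT w:ball 0 \<rho>|lborel. h w)"
proof (cases "\<rho> > 0")
  case False
  then have "indicator (ball (0::complex) \<rho>) w = (0 :: real)" for w
    by (simp add: indicator_def) (metis norm_ge_zero order_le_less_trans)
  then show ?thesis by (simp add: set_lebesgue_integral_def)
next
  case True
  have M0: "M n \<ge> 0" for n
    using order_trans[OF norm_ge_zero le[of 0 n]] True by simp
  have int: "set_integrable lborel (ball 0 \<rho>) (g n)" for n
    by (rule integrable_bounded_on_disc[OF assms(1) le])
  let ?G = "\<lambda>n w. indicator (ball 0 \<rho>) w *\<^sub>R g n w"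
  have GM: "norm (?G n w) \<le> M n" for n w
    using le M0 by (auto simp: indicator_def)
  have "(\<lambda>n. integral\<^sup>L lborel (?G n)) sums (LINT w|lborel. (\<Sum>n. ?G n w))"
  proof (rule sums_integral)
    show "integrable lborel (?G n)" for n
      using int[of n] by (simp add: set_integrable_def)
    show "AE w in lborel. summable (\<lambda>n. norm (?G n w))"
      using GM by (intro AE_I2 summable_comparison_test'[OF \<open>summable M\<close>, of 0]) simp
    have "(LINT w|lborel. norm (?G n w)) \<le> M n * (pi * \<rho>\<^sup>2)" for n
    proof -
      have "(LINT w|lborel. norm (?G n w)) \<le> (LINT w|lborel. indicator (ball (0::complex) \<rho>) w * M n)"
      proof (rule integral_mono)
        show "integrable lborel (\<lambda>w. norm (?G n w))"
          by (rule integrable_norm[OF int[unfolded set_integrable_def]])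
        show "integrable lborel (\<lambda>w. indicator (ball (0::complex) \<rho>) w * M n)"
          by (intro integrable_mult_left) (use emeasure_lborel_ball_finite in \<open>auto simp: integrable_indicator_iff\<close>)
      qed (use le M0 in \<open>auto simp: indicator_def\<close>)
      also have "\<dots> = M n * (pi * \<rho>\<^sup>2)"
        using True by (simp add: measure_def emeasure_complex_ball)
      finally show ?thesis .
    qed
    then show "summable (\<lambda>n. LINT w|lborel. norm (?G n w))"
      by (intro summable_comparison_test'[OF summable_mult2[OF \<open>summable M\<close>, of "pi * \<rho>\<^sup>2"], of 0]) simp
  qed
  moreover have "(\<Sum>n. ?G n w) = indicator (ball 0 \<rho>) w *\<^sub>R h w" for w
    using sums[of w] by (auto simp: indicator_def sums_iff)
  ultimately show ?thesis by (simp add: set_lebesgue_integral_def)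
qed

lemma norm_disc_mult_less: 
  fixes z w :: complex
  assumes "norm z < 1" "norm w < 1"
  shows "norm (z * w) < 1"
  using assms mult_strict_mono'[of "norm z" 1 "norm w" 1] by (simp add: norm_mult)

text \<open>The kernel expands into the terms (m+1) z^m conj(w)^m. Orthogonality leaves only m = n,
  and the factor n + 1 cancels the denominator in \<open>disc_monomial_norm\<close>.\<close>

lemma disc_bergman_monomial:
  assumes z: "norm z < 1" and \<rho>: "0 < \<rho>" "\<rho> \<le> 1"
  shows "(LINT w:ball 0 \<rho>|lborel. w ^ n / (1 - z * cnj w)\<^sup>2) = of_real (pi * \<rho> ^ (2 * n + 2)) * z ^ n"
proof -
  have "(\<lambda>m. LINT w:ball 0 \<rho>|lborel. of_nat (Suc m) * z ^ m * (w ^ n * cnj w ^ m)) sums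
      (LINT w:ball 0 \<rho>|lborel. w ^ n / (1 - z * cnj w)\<^sup>2)"
  proof (rule disc_integral_sums[where M = "\<lambda>m. of_nat (Suc m) * norm z ^ m"])
    show "norm (of_nat (Suc m) * z ^ m * (w ^ n * cnj w ^ m)) \<le> of_nat (Suc m) * norm z ^ m"
      if "w \<in> ball 0 \<rho>" for m w
    proof -
      have "norm w \<le> 1" using that \<rho> by auto
      then have "norm (w ^ n * cnj w ^ m) \<le> 1"
        by (simp add: norm_mult norm_power mult_le_one power_le_one)
      then show ?thesis
        by (simp add: norm_mult norm_power mult_left_le del: of_nat_Suc)
    qed
    show "summable (\<lambda>m. of_nat (Suc m) * norm z ^ m)"
      using z geometric_deriv_sums[of "norm z"] by (simp add: sums_iff)
    show "(\<lambda>m. of_nat (Suc m) * z ^ m * (w ^ n * cnj w ^ m)) sums (w ^ n / (1 - z * cnj w)\<^sup>2)"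
      if "w \<in> ball 0 \<rho>" for w
    proof -
      have "norm (z * cnj w) < 1"
        using that z \<rho> by (intro norm_disc_mult_less) auto
      from sums_mult[OF geometric_deriv_sums[OF this], of "w ^ n"] show ?thesis
        by (simp add: power_mult_distrib mult_ac)
    qed
  qed (intro continuous_intros)
  moreover have "(\<lambda>m. LINT w:ball 0 \<rho>|lborel. of_nat (Suc m) * z ^ m * (w ^ n * cnj w ^ m)) =
      (\<lambda>m. if m = n then of_real (pi * \<rho> ^ (2 * n + 2)) * z ^ n else 0)"
    using \<rho> by (auto simp: fun_eq_iff disc_monomials_orthogonal disc_monomial_norm
        simp del: of_nat_Suc) 
  ultimately show ?thesis
    using sums_single[of n "\<lambda>m. of_real (pi * \<rho> ^ (2 * n + 2)) * z ^ n"] sums_unique2 by fastforce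
qed

lemma bergman_denominator_bound:
  fixes z w :: complex
  assumes "norm z < 1" "norm w \<le> 1"
  shows "norm (1 / (1 - z * cnj w)\<^sup>2) \<le> 1 / (1 - norm z)\<^sup>2"
proof -
  have "norm (z * cnj w) \<le> norm z"
    using assms by (simp add: norm_mult mult_left_le)
  then have "1 - norm z \<le> norm (1 - z * cnj w)"
    using norm_triangle_ineq2[of 1 "z * cnj w"] by simp
  then show ?thesis
    using assms by (simp add: norm_divide norm_power frac_le power_mono)
qed

text \<open>The smaller disc makes the Taylor series of F absolutely and uniformly convergent, so
  that it can be integrated termwise. The kernel is still that of the unit disc; the factors
  rho^(2n) produced by the monomials therefore reappear as the dilation of z by rho^2.\<close>

lemma disc_bergman_smaller_disc:
  assumes F: "F holomorphic_on ball 0 1" and z: "norm z < 1" and \<rho>: "0 < \<rho>" "\<rho> < 1"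
  shows "(LINT w:ball 0 \<rho>|lborel. F w / (1 - z * cnj w)\<^sup>2) = of_real (pi * \<rho>\<^sup>2) * F (of_real (\<rho>\<^sup>2) * z)"
proof -
  define a where "a n = (deriv ^^ n) F 0 / fact n" for n
  have Fsums: "(\<lambda>n. a n * w ^ n) sums F w" if "norm w < 1" for w
    using holomorphic_power_series[OF F, of w] that by (simp add: a_def)
  have "(\<lambda>n. LINT w:ball 0 \<rho>|lborel. a n * (w ^ n / (1 - z * cnj w)\<^sup>2)) sums
      (LINT w:ball 0 \<rho>|lborel. F w / (1 - z * cnj w)\<^sup>2)"
  proof (rule disc_integral_sums[where M = "\<lambda>n. norm (a n * of_real \<rho> ^ n) * (1 / (1 - norm z)\<^sup>2)"])
    show "norm (a n * (w ^ n / (1 - z * cnj w)\<^sup>2)) \<le> norm (a n * of_real \<rho> ^ n) * (1 / (1 - norm z)\<^sup>2)"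
      if "w \<in> ball 0 \<rho>" for n w
    proof -
      have "norm (a n * w ^ n * (1 / (1 - z * cnj w)\<^sup>2)) \<le> norm (a n * of_real \<rho> ^ n) * (1 / (1 - norm z)\<^sup>2)"
        unfolding norm_mult[of "a n * w ^ n"] using that \<rho> z
        by (intro mult_mono bergman_denominator_bound) (auto simp: norm_mult norm_power intro!: mult_left_mono power_mono)
      then show ?thesis by simp
    qed
    \<comment> \<open>Convergence of the Taylor series at the intermediate radius sigma gives
      absolute convergence at rho.\<close>
    obtain \<sigma> where \<sigma>: "\<rho> < \<sigma>" "\<sigma> < 1" using \<rho> dense by blast
    have "summable (\<lambda>n. a n * of_real \<sigma> ^ n)"
      using Fsums[of "of_real \<sigma>"] \<sigma> \<rho> by (auto simp: sums_iff)
    then have "summable (\<lambda>n. norm (a n * of_real \<rho> ^ n))"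
      using \<sigma> \<rho> by (intro powser_insidea) auto
    then show "summable (\<lambda>n. norm (a n * of_real \<rho> ^ n) * (1 / (1 - norm z)\<^sup>2))"
      by (rule summable_mult2)
    show "(\<lambda>n. a n * (w ^ n / (1 - z * cnj w)\<^sup>2)) sums (F w / (1 - z * cnj w)\<^sup>2)" if "w \<in> ball 0 \<rho>" for w
      using sums_divide[OF Fsums[of w], of "(1 - z * cnj w)\<^sup>2"] that \<rho> by simp
    show "continuous_on (ball 0 \<rho>) (\<lambda>w. a n * (w ^ n / (1 - z * cnj w)\<^sup>2))" for n
    proof (intro continuous_intros ballI)
      fix w assume "w \<in> ball (0::complex) \<rho>"
      then have "norm (z * cnj w) < 1"
        using z \<rho> by (intro norm_disc_mult_less) auto
      then show "(1 - z * cnj w)\<^sup>2 \<noteq> 0" by auto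
    qed
  qed
  moreover have "(LINT w:ball 0 \<rho>|lborel. a n * (w ^ n / (1 - z * cnj w)\<^sup>2)) =
      of_real (pi * \<rho>\<^sup>2) * (a n * (of_real (\<rho>\<^sup>2) * z) ^ n)" for n
    unfolding set_integral_mult_right disc_bergman_monomial[OF z \<rho>(1) less_imp_le[OF \<rho>(2)]]
    by (simp add: power_mult_distrib power_mult power_add) (simp add: power2_eq_square)
  moreover have "(\<lambda>n. of_real (pi * \<rho>\<^sup>2) * (a n * (of_real (\<rho>\<^sup>2) * z) ^ n)) sums
      (of_real (pi * \<rho>\<^sup>2) * F (of_real (\<rho>\<^sup>2) * z))"
  proof (intro sums_mult Fsums norm_disc_mult_less z)
    show "norm (complex_of_real (\<rho>\<^sup>2)) < 1"
      using \<rho> by (simp add: norm_power power_less_one_iff abs_square_less_1)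
  qed
  ultimately show ?thesis
    by (simp add: sums_unique2)
qed

text \<open>Let rho tend to 1 in \<open>disc_bergman_smaller_disc\<close>. The kernel is bounded in
  w for fixed z, so a multiple of |F| dominates the left side; on the right side F is continuous at
  z.\<close>

theorem disc_bergman_reproducing:
  assumes F: "F holomorphic_on ball 0 1" and int: "set_integrable lborel (ball 0 1) F" and z: "norm z < 1"
  shows "(LINT w:ball 0 1|lborel. F w / (1 - z * cnj w)\<^sup>2) = of_real pi * F z"
proof -
  \<comment> \<open>The shift by 2 keeps every radius strictly between 0 and 1.\<close>
  define \<rho> where "\<rho> n = 1 - 1 / real (n + 2)" for n
  have \<rho>: "0 < \<rho> n" "\<rho> n < 1" for n
    by (simp_all add: \<rho>_def)
  have \<rho>_lim: "\<rho> \<longlonglongrightarrow> 1"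
    unfolding \<rho>_def by real_asymp
  have norm_lim: "F w / (1 - z * cnj w)\<^sup>2 = F w * (1 / (1 - z * cnj w)\<^sup>2)" for w
    by simp
  have den: "norm (1 / (1 - z * cnj w)\<^sup>2) \<le> 1 / (1 - norm z)\<^sup>2" if "w \<in> ball 0 1" for w
    using that z by (intro bergman_denominator_bound) auto
  have cont: "continuous_on (ball 0 1) (\<lambda>w. F w / (1 - z * cnj w)\<^sup>2)"
  proof (intro continuous_intros holomorphic_on_imp_continuous_on[OF F] ballI)
    fix w assume "w \<in> ball (0::complex) 1"
    then have "norm (z * cnj w) < 1"
      using z by (intro norm_disc_mult_less) auto
    then show "(1 - z * cnj w)\<^sup>2 \<noteq> 0" by auto
  qed
  have "(\<lambda>n. LINT w|lborel. indicator (ball 0 (\<rho> n)) w *\<^sub>R (F w / (1 - z * cnj w)\<^sup>2)) \<longlonglongrightarrow>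
      (LINT w|lborel. indicator (ball 0 1) w *\<^sub>R (F w / (1 - z * cnj w)\<^sup>2))"
  proof (rule integral_dominated_convergence)
    show "integrable lborel (\<lambda>w. norm (indicator (ball 0 1) w *\<^sub>R F w) * (1 / (1 - norm z)\<^sup>2))"
      using int by (intro integrable_mult_left integrable_norm) (simp add: set_integrable_def)
    show "(\<lambda>w. indicator (ball 0 1) w *\<^sub>R (F w / (1 - z * cnj w)\<^sup>2)) \<in> borel_measurable lborel"
      using borel_measurable_continuous_on_indicator[OF _ cont] by simp
    show "(\<lambda>w. indicator (ball 0 (\<rho> n)) w *\<^sub>R (F w / (1 - z * cnj w)\<^sup>2)) \<in> borel_measurable lborel" for n
      using borel_measurable_continuous_on_indicator[OF _ continuous_on_subset[OF cont], of "ball 0 (\<rho> n)"] \<rho>[of n]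
      by (simp add: subset_ball less_imp_le)
    show "AE w in lborel. norm (indicator (ball 0 (\<rho> n)) w *\<^sub>R (F w / (1 - z * cnj w)\<^sup>2))
        \<le> norm (indicator (ball 0 1) w *\<^sub>R F w) * (1 / (1 - norm z)\<^sup>2)" for n
    proof (rule AE_I2)
      fix w :: complex
      show "norm (indicator (ball 0 (\<rho> n)) w *\<^sub>R (F w / (1 - z * cnj w)\<^sup>2))
        \<le> norm (indicator (ball 0 1) w *\<^sub>R F w) * (1 / (1 - norm z)\<^sup>2)"
      proof (cases "w \<in> ball 0 (\<rho> n)")
        case True
        then have "w \<in> ball 0 1" using \<rho>[of n] by auto
        with True show ?thesis
          unfolding norm_lim using mult_left_mono[OF den norm_ge_zero, of w "F w"]
          by (simp only: indicator_simps scaleR_one norm_mult)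
      qed simp
    qed
    show "AE w in lborel. (\<lambda>n. indicator (ball 0 (\<rho> n)) w *\<^sub>R (F w / (1 - z * cnj w)\<^sup>2)) \<longlonglongrightarrow>
        indicator (ball 0 1) w *\<^sub>R (F w / (1 - z * cnj w)\<^sup>2)"
    proof (rule AE_I2)
      fix w :: complex
      have "eventually (\<lambda>n. indicator (ball 0 (\<rho> n)) w = (indicator (ball 0 1) w :: real)) sequentially"
      proof (cases "norm w < 1")
        case True
        have "eventually (\<lambda>n. norm w < \<rho> n) sequentially"
          using order_tendstoD(1)[OF \<rho>_lim True] .
        then show ?thesis using True by (auto elim!: eventually_mono simp: indicator_def)
      next
        case False
        then have "\<not> norm w < \<rho> n" for n
          using \<rho>(2)[of n] by linarith
        then show ?thesis using False by (simp add: indicator_def)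
      qed
      then show "(\<lambda>n. indicator (ball 0 (\<rho> n)) w *\<^sub>R (F w / (1 - z * cnj w)\<^sup>2)) \<longlonglongrightarrow>
          indicator (ball 0 1) w *\<^sub>R (F w / (1 - z * cnj w)\<^sup>2)"
        by (intro tendsto_eventually) (auto elim!: eventually_mono)
    qed
  qed
  moreover have "(LINT w|lborel. indicator (ball 0 (\<rho> n)) w *\<^sub>R (F w / (1 - z * cnj w)\<^sup>2)) =
      of_real (pi * (\<rho> n)\<^sup>2) * F (of_real ((\<rho> n)\<^sup>2) * z)" for n
    using disc_bergman_smaller_disc[OF F z \<rho>] by (simp add: set_lebesgue_integral_def)
  moreover have "(\<lambda>n. of_real (pi * (\<rho> n)\<^sup>2) * F (of_real ((\<rho> n)\<^sup>2) * z)) \<longlonglongrightarrow> of_real (pi * 1\<^sup>2) * F (of_real (1\<^sup>2) * z)"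
  proof (intro tendsto_intros \<rho>_lim)
    have "isCont F z"
      using holomorphic_on_imp_continuous_on[OF F] z
      by (simp add: continuous_on_eq_continuous_at)
    moreover have "(\<lambda>n. of_real ((\<rho> n)\<^sup>2) * z) \<longlonglongrightarrow> of_real (1\<^sup>2) * z"
      by (intro tendsto_intros \<rho>_lim)
    ultimately show "(\<lambda>n. F (of_real ((\<rho> n)\<^sup>2) * z)) \<longlonglongrightarrow> F (of_real (1\<^sup>2) * z)"
      by (auto intro: isCont_tendsto_compose)
  qed
  ultimately show ?thesis
    using LIMSEQ_unique by (fastforce simp: set_lebesgue_integral_def)
qed

section \<open>The slices of the quaternions\<close>

text \<open>The embedding of the complex field as the real algebra C(j), sending the imaginary unit
  to j. Computations on a slice become computations with complex numbers.\<close>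

definition slice_embed :: "quat \<Rightarrow> complex \<Rightarrow> quat" where
  "slice_embed j z = slice_point j (Re z) (Im z)"

lemma imag_sphereD:
  assumes "j \<in> imag_sphere"
  shows "qRe j = 0" and "qIm1 j * qIm1 j + qIm2 j * qIm2 j + qIm3 j * qIm3 j = 1"
    and "j * j = - 1"
proof -
  show 1: "qRe j = 0" using assms by (simp add: imag_sphere_def)
  show 2: "qIm1 j * qIm1 j + qIm2 j * qIm2 j + qIm3 j * qIm3 j = 1"
    using assms 1 by (simp add: imag_sphere_def norm_quat_eq power2_eq_square)
  show "j * j = - 1"
    using 1 2 by (simp add: quat_eq_iff)
qed

lemma slice_embed_sel:
  assumes "j \<in> imag_sphere"
  shows "qRe (slice_embed j z) = Re z" "qIm1 (slice_embed j z) = Im z * qIm1 j"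
    "qIm2 (slice_embed j z) = Im z * qIm2 j" "qIm3 (slice_embed j z) = Im z * qIm3 j"
  using assms by (simp_all add: slice_embed_def slice_point_def imag_sphereD)

lemma slice_embed_of_real [simp]: "slice_embed j (of_real x) = of_real x"
  by (simp add: slice_embed_def slice_point_def)

lemma slice_embed_add: "slice_embed j (z + w) = slice_embed j z + slice_embed j w"
  by (simp add: slice_embed_def slice_point_def algebra_simps)

lemma slice_embed_diff: "slice_embed j (z - w) = slice_embed j z - slice_embed j w"
  by (simp add: slice_embed_def slice_point_def algebra_simps)

lemma slice_embed_minus: "slice_embed j (- z) = - slice_embed j z"
  by (simp add: slice_embed_def slice_point_def algebra_simps)

lemma slice_embed_scaleR: "slice_embed j (c *\<^sub>R z) = c *\<^sub>R slice_embed j z"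
  by (simp add: slice_embed_def slice_point_def scaleR_conv_of_real algebra_simps)

lemma slice_embed_1 [simp]: "slice_embed j 1 = 1"
  and slice_embed_0 [simp]: "slice_embed j 0 = 0"
  and slice_embed_ii [simp]: "slice_embed j \<i> = j"
  by (simp_all add: slice_embed_def slice_point_def)

lemma slice_embed_numeral [simp]: "slice_embed j (numeral n) = numeral n"
  using slice_embed_of_real[of j "numeral n"] by (simp del: slice_embed_of_real)

lemma slice_embed_eq_0_iff:
  assumes "j \<in> imag_sphere"
  shows "slice_embed j z = 0 \<longleftrightarrow> z = 0"
  using imag_sphereD(2)[OF assms]
  by (auto simp: quat_eq_iff slice_embed_sel[OF assms] complex_eq_iff)

lemma slice_embed_mult:
  assumes "j \<in> imag_sphere"
  shows "slice_embed j (z * w) = slice_embed j z * slice_embed j w"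
  by (simp add: slice_embed_def slice_point_def of_real_def imag_sphereD[OF assms] algebra_simps)

lemma slice_embed_power: "j \<in> imag_sphere \<Longrightarrow> slice_embed j (z ^ n) = slice_embed j z ^ n"
  by (induction n) (simp_all add: slice_embed_mult)

lemma slice_embed_inverse:
  assumes "j \<in> imag_sphere"
  shows "slice_embed j (inverse z) = inverse (slice_embed j z)"
proof (cases "z = 0")
  case False
  then have "slice_embed j z * slice_embed j (inverse z) = 1"
    by (simp flip: slice_embed_mult[OF assms])
  then show ?thesis
    by (rule inverse_unique[symmetric])
qed simp

lemmas slice_embed_hom = slice_embed_add slice_embed_diff slice_embed_minus slice_embed_scaleR
  slice_embed_mult slice_embed_power slice_embed_inverse

lemma qcnj_slice_embed: "j \<in> imag_sphere \<Longrightarrow> qcnj (slice_embed j z) = slice_embed j (cnj z)"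
  by (simp add: quat_eq_iff slice_embed_sel)

lemma norm_slice_embed:
  assumes "j \<in> imag_sphere"
  shows "norm (slice_embed j z) = norm z"
proof -
  have "(Im z * qIm1 j)\<^sup>2 + (Im z * qIm2 j)\<^sup>2 + (Im z * qIm3 j)\<^sup>2 =
      (Im z)\<^sup>2 * (qIm1 j * qIm1 j + qIm2 j * qIm2 j + qIm3 j * qIm3 j)"
    by (simp add: algebra_simps power2_eq_square)
  also have "\<dots> = (Im z)\<^sup>2"
    by (simp only: imag_sphereD(2)[OF assms] mult_1_right)
  finally show ?thesis
    by (simp add: norm_quat_eq slice_embed_sel[OF assms] cmod_def add.assoc)
qed

lemma bounded_linear_slice_embed: "bounded_linear (slice_embed j)"
  by (intro bounded_linearI' linear_conv_bounded_linear[THEN iffD1] linearI)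
     (simp_all add: slice_embed_add slice_embed_scaleR)

text \<open>A nonreal quaternion determines its unit up to sign, as the normalised imaginary part; a
  real one lies on every slice, and \<open>quat_ii\<close> is picked.\<close>

lemma slice_embed_surj:
  obtains j z where "j \<in> imag_sphere" "q = slice_embed j z"
proof (cases "q = of_real (qRe q)")
  case True
  have "quat_ii \<in> imag_sphere" by (simp add: imag_sphere_def norm_quat_eq)
  moreover have "q = slice_embed quat_ii (of_real (qRe q))" using True by simp
  ultimately show ?thesis by (rule that)
next
  case False
  define v where "v = q - of_real (qRe q)"
  have v: "v \<noteq> 0" "qRe v = 0" using False by (simp_all add: v_def)
  have "sgn v \<in> imag_sphere"
    using v by (simp add: imag_sphere_def norm_sgn sgn_quat_def)
  moreover have "q = slice_embed (sgn v) (Complex (qRe q) (norm v))"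
    using v by (simp add: slice_embed_def slice_point_def sgn_div_norm of_real_def) (simp add: v_def of_real_def)
  ultimately show ?thesis by (rule that)
qed

lemma slice_point_eq_slice_embed: "slice_point j x y = slice_embed j (Complex x y)"
  by (simp add: slice_embed_def)

lemma slice_ball_iff:
  assumes "j \<in> imag_sphere"
  shows "r \<in> slice quat_ball j \<longleftrightarrow> (\<exists>z. norm z < 1 \<and> r = slice_embed j z)"
proof -
  have "r \<in> slice_plane j \<longleftrightarrow> (\<exists>z. r = slice_embed j z)"
    unfolding slice_plane_def slice_embed_def
    by (auto intro: exI[where x = "Complex _ _"])
  then show ?thesis by (auto simp: slice_def norm_slice_embed[OF assms])
qed

section \<open>The Laplacian and the Fueter operator on axial functions\<close>

lemma bounded_linear_qRe: "bounded_linear qRe"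
  by (intro bounded_linearI' linear_conv_bounded_linear[THEN iffD1] linearI) simp_all

lemma bounded_linear_qcnj: "bounded_linear qcnj"
  by (intro bounded_linearI' linear_conv_bounded_linear[THEN iffD1] linearI) (simp_all add: quat_eq_iff)

lemmas qRe_has_derivative [derivative_intros] = bounded_linear.has_derivative[OF bounded_linear_qRe]
lemmas qcnj_has_derivative [derivative_intros] = bounded_linear.has_derivative[OF bounded_linear_qcnj]

text \<open>The explicit formula \<open>G\<close> needs to agree with \<open>F\<close> only near
  \<open>q\<close>. This allows iterated partial derivatives, where the inner one is known only on
  \<open>S\<close>.\<close>

lemma qpartial_eqI:
  assumes "open S" "q \<in> S" "\<And>p. p \<in> S \<Longrightarrow> G p = F p" "(G has_derivative D) (at q)"
  shows "qpartial e F q = D e"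
proof -
  have "(F has_derivative D) (at q)"
    using has_derivative_transform_within_open[OF assms(4,1,2)] assms(3) by blast
  then have "(F has_derivative D) (at (q + 0 *\<^sub>R e))" by simp
  moreover have "((\<lambda>t. q + t *\<^sub>R e) has_derivative (\<lambda>t. t *\<^sub>R e)) (at 0)"
    by (auto intro!: derivative_eq_intros)
  ultimately have "((\<lambda>t. F (q + t *\<^sub>R e)) has_derivative (\<lambda>t. D (t *\<^sub>R e))) (at 0)"
    by (rule has_derivative_compose[rotated])
  moreover have "D (t *\<^sub>R e) = t *\<^sub>R D e" for t
    using assms(4) by (simp add: has_derivative_def linear_simps)
  ultimately show ?thesis
    by (simp add: qpartial_def vector_derivative_at has_vector_derivative_def)
qed

text \<open>\<open>Gx\<close> and \<open>Gs\<close> play the role of the partial derivatives of a function \<open>G\<close> of the two real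
  variables \<open>x = qRe q\<close> and \<open>s = (norm q)\<^sup>2\<close>.\<close>

definition has_axial_partials ::
  "quat set \<Rightarrow> (quat \<Rightarrow> quat) \<Rightarrow> (quat \<Rightarrow> quat) \<Rightarrow> (quat \<Rightarrow> quat) \<Rightarrow> bool" where
  "has_axial_partials S G Gx Gs \<longleftrightarrow>
     (\<forall>q\<in>S. (G has_derivative (\<lambda>h. qRe h *\<^sub>R Gx q + (2 * (q \<bullet> h)) *\<^sub>R Gs q)) (at q))"

lemma has_axial_partialsD:
  "has_axial_partials S G Gx Gs \<Longrightarrow> q \<in> S \<Longrightarrow>
     (G has_derivative (\<lambda>h. qRe h *\<^sub>R Gx q + (2 * (q \<bullet> h)) *\<^sub>R Gs q)) (at q)"
  by (simp add: has_axial_partials_def)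

lemma differentiable_axial:
  assumes "open S" "q \<in> S" "has_axial_partials S A Ax As" "has_axial_partials S B Bx Bs"
    and "\<And>p. p \<in> S \<Longrightarrow> F p = A p + qcnj p * B p"
  shows "F differentiable (at q)"
proof -
  have D: "((\<lambda>p. A p + qcnj p * B p) has_derivative (\<lambda>h. (qRe h *\<^sub>R Ax q + (2 * (q \<bullet> h)) *\<^sub>R As q) +
      (qcnj q * (qRe h *\<^sub>R Bx q + (2 * (q \<bullet> h)) *\<^sub>R Bs q) + qcnj h * B q))) (at q)"
    by (intro derivative_intros has_axial_partialsD[OF assms(3,2)] has_axial_partialsD[OF assms(4,2)])
  have "(F has_derivative (\<lambda>h. (qRe h *\<^sub>R Ax q + (2 * (q \<bullet> h)) *\<^sub>R As q) +
      (qcnj q * (qRe h *\<^sub>R Bx q + (2 * (q \<bullet> h)) *\<^sub>R Bs q) + qcnj h * B q))) (at q)"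
    by (rule has_derivative_transform_within_open[OF D assms(1,2)]) (simp add: assms(5))
  then show ?thesis by (auto simp: differentiable_def)
qed

lemma qpartial_axial:
  assumes "open S" "q \<in> S" "has_axial_partials S A Ax As" "has_axial_partials S B Bx Bs"
    and "\<And>p. p \<in> S \<Longrightarrow> F p = A p + qcnj p * B p"
  shows "qpartial e F q = qRe e *\<^sub>R Ax q + (2 * (q \<bullet> e)) *\<^sub>R As q + qcnj e * B q +
    qcnj q * (qRe e *\<^sub>R Bx q + (2 * (q \<bullet> e)) *\<^sub>R Bs q)"
proof (rule qpartial_eqI[where S = S])
  show "((\<lambda>p. A p + qcnj p * B p) has_derivative (\<lambda>e. qRe e *\<^sub>R Ax q + (2 * (q \<bullet> e)) *\<^sub>R As q + qcnj e * B q +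
    qcnj q * (qRe e *\<^sub>R Bx q + (2 * (q \<bullet> e)) *\<^sub>R Bs q))) (at q)"
    using assms(2-4) by (auto intro!: derivative_eq_intros dest: has_axial_partialsD simp: algebra_simps)
qed (use assms in auto)

text \<open>Summing over the four basis vectors e uses that the sums of (q.e)^2, of Re(e) (q.e) and
  of e.e are |q|^2, Re q and 4. The last sum yields the coefficient 8 of \<open>As\<close>. For B
  the product rule with conj(q) adds twice the sum of conj(e) (Re(e) Bx + 2 (q.e) Bs), that is 2 Bx
  + 4 conj(q) Bs; this explains the term in \<open>Bx\<close> and the coefficient 12 = 8 +
  4.\<close>

lemma qlaplacian_axial:
  assumes S: "open S" "q \<in> S"
    and A: "has_axial_partials S A Ax As" "has_axial_partials S Ax Axx Axs" "has_axial_partials S As Axs Ass"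
    and B: "has_axial_partials S B Bx Bs" "has_axial_partials S Bx Bxx Bxs" "has_axial_partials S Bs Bxs Bss"
    and F: "\<And>p. p \<in> S \<Longrightarrow> F p = A p + qcnj p * B p"
  shows "qlaplacian F q =
    Axx q + (4 * qRe q) *\<^sub>R Axs q + (4 * (norm q)\<^sup>2) *\<^sub>R Ass q + 8 *\<^sub>R As q + 2 *\<^sub>R Bx q +
    qcnj q * (Bxx q + (4 * qRe q) *\<^sub>R Bxs q + (4 * (norm q)\<^sup>2) *\<^sub>R Bss q + 12 *\<^sub>R Bs q)"
proof -
  have second: "qpartial e (qpartial e F) q =
      qRe e *\<^sub>R (qRe e *\<^sub>R Axx q + (2 * (q \<bullet> e)) *\<^sub>R Axs q) +
      (2 * (e \<bullet> e)) *\<^sub>R As q + (2 * (q \<bullet> e)) *\<^sub>R (qRe e *\<^sub>R Axs q + (2 * (q \<bullet> e)) *\<^sub>R Ass q) +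
      qcnj e * (qRe e *\<^sub>R Bx q + (2 * (q \<bullet> e)) *\<^sub>R Bs q) +
      qcnj e * (qRe e *\<^sub>R Bx q + (2 * (q \<bullet> e)) *\<^sub>R Bs q) +
      qcnj q * (qRe e *\<^sub>R (qRe e *\<^sub>R Bxx q + (2 * (q \<bullet> e)) *\<^sub>R Bxs q) +
        (2 * (e \<bullet> e)) *\<^sub>R Bs q + (2 * (q \<bullet> e)) *\<^sub>R (qRe e *\<^sub>R Bxs q + (2 * (q \<bullet> e)) *\<^sub>R Bss q))"
    (is "_ = ?D e") for e
  proof -
    have first: "qRe e *\<^sub>R Ax p + (2 * (p \<bullet> e)) *\<^sub>R As p + qcnj e * B p +
        qcnj p * (qRe e *\<^sub>R Bx p + (2 * (p \<bullet> e)) *\<^sub>R Bs p) = qpartial e F p" if "p \<in> S" for p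
      using qpartial_axial[OF S(1) that A(1) B(1)] F by simp
    note partials = has_axial_partialsD[OF A(1) S(2)] has_axial_partialsD[OF A(2) S(2)]
      has_axial_partialsD[OF A(3) S(2)] has_axial_partialsD[OF B(1) S(2)] has_axial_partialsD[OF B(2) S(2)]
      has_axial_partialsD[OF B(3) S(2)]
    have "((\<lambda>p. qRe e *\<^sub>R Ax p + (2 * (p \<bullet> e)) *\<^sub>R As p + qcnj e * B p +
        qcnj p * (qRe e *\<^sub>R Bx p + (2 * (p \<bullet> e)) *\<^sub>R Bs p)) has_derivative 
     (\<lambda>h. qRe e *\<^sub>R (qRe h *\<^sub>R Axx q + (2 * (q \<bullet> h)) *\<^sub>R Axs q) +
      ((2 * (h \<bullet> e)) *\<^sub>R As q + (2 * (q \<bullet> e)) *\<^sub>R (qRe h *\<^sub>R Axs q + (2 * (q \<bullet> h)) *\<^sub>R Ass q)) +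
      qcnj e * (qRe h *\<^sub>R Bx q + (2 * (q \<bullet> h)) *\<^sub>R Bs q) +
      (qcnj h * (qRe e *\<^sub>R Bx q + (2 * (q \<bullet> e)) *\<^sub>R Bs q) +
      qcnj q * (qRe e *\<^sub>R (qRe h *\<^sub>R Bxx q + (2 * (q \<bullet> h)) *\<^sub>R Bxs q) +
        ((2 * (h \<bullet> e)) *\<^sub>R Bs q + (2 * (q \<bullet> e)) *\<^sub>R (qRe h *\<^sub>R Bxs q + (2 * (q \<bullet> h)) *\<^sub>R Bss q)))))) (at q)"
      (is "(_ has_derivative ?L) _")
      apply (rule has_derivative_eq_rhs)
       apply (rule has_derivative_add has_derivative_mult has_derivative_scaleR has_derivative_const qcnj_has_derivative has_derivative_ident
           has_derivative_inner_left  partials)+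
      apply (simp add: algebra_simps)
      done
    from qpartial_eqI[OF S first this]
    have "qpartial e (qpartial e F) q = ?L e" .
    then show ?thesis by (simp add: algebra_simps)
  qed
  show ?thesis
    unfolding qlaplacian_def second
    by (simp add: quat_eq_iff inner_quat_def norm_quat_eq algebra_simps power2_eq_square)
qed

text \<open>The sum of e (q.e) is q, so \<open>As\<close> receives the left factor 2 q, rewritten as
  4 Re(q) - 2 conj(q) to restore the form A + conj(q) B. The sum of e conj(e) is 4, and q conj(q) =
  |q|^2 makes the contribution of \<open>Bs\<close> free of conj(q).\<close>

lemma fueter_axial:
  assumes S: "open S" "q \<in> S" and A: "has_axial_partials S A Ax As" and B: "has_axial_partials S B Bx Bs"
    and F: "\<And>p. p \<in> S \<Longrightarrow> F p = A p + qcnj p * B p"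
  shows "qpartial 1 F q + quat_ii * qpartial quat_ii F q + quat_jj * qpartial quat_jj F q
      + quat_kk * qpartial quat_kk F q =
    Ax q + (4 * qRe q) *\<^sub>R As q + 4 *\<^sub>R B q + (2 * (norm q)\<^sup>2) *\<^sub>R Bs q + qcnj q * (Bx q - 2 *\<^sub>R As q)"
proof -
  have first: "qpartial e F q = qRe e *\<^sub>R Ax q + (2 * (q \<bullet> e)) *\<^sub>R As q + qcnj e * B q +
    qcnj q * (qRe e *\<^sub>R Bx q + (2 * (q \<bullet> e)) *\<^sub>R Bs q)" for e
    using F by (rule qpartial_axial[OF S A B])
  show ?thesis
    unfolding first
    by (simp add: quat_eq_iff inner_quat_def norm_quat_eq algebra_simps power2_eq_square)
qed

section \<open>The kernels in closed form\<close>

text \<open>For \<open>x = qRe q\<close> and \<open>s = (norm q)\<^sup>2\<close> the left power series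
  \<open>\<Sum>n. (n + 1) q\<^sup>n p\<^sup>n\<close> times \<open>1 / pi\<close>, with \<open>p\<close> the conjugate of the second variable of the
  kernel, sums to \<open>ball_kernel q p\<close>: since \<open>q\<^sup>2 = 2 x q - s\<close> the factor \<open>bergman_den x s p\<close> is a
  real polynomial in \<open>p\<close> alone, and \<open>qcnj q\<close> is the only quaternion that does not commute with \<open>p\<close>.
  The coefficients \<open>fueter_fst\<close> and \<open>fueter_snd\<close> are the result of applying the Laplacian.\<close>

definition bergman_den :: "real \<Rightarrow> real \<Rightarrow> 'a::real_normed_div_algebra \<Rightarrow> 'a" where
  "bergman_den x s p = 1 - (2 * x) *\<^sub>R p + s *\<^sub>R p ^ 2"

definition kernel_fst :: "real \<Rightarrow> real \<Rightarrow> 'a::real_normed_div_algebra \<Rightarrow> 'a" where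
  "kernel_fst x s p = (1 / pi) *\<^sub>R ((1 - s *\<^sub>R p ^ 2) * inverse (bergman_den x s p) ^ 2)"

definition kernel_snd :: "real \<Rightarrow> real \<Rightarrow> 'a::real_normed_div_algebra \<Rightarrow> 'a" where
  "kernel_snd x s p = (- 2 / pi) *\<^sub>R (p * (1 - x *\<^sub>R p) * inverse (bergman_den x s p) ^ 2)"

definition fueter_fst :: "real \<Rightarrow> real \<Rightarrow> 'a::real_normed_div_algebra \<Rightarrow> 'a" where
  "fueter_fst x s p =
     (- 4 / pi) *\<^sub>R (p ^ 2 * (3 - (2 * x) *\<^sub>R p - s *\<^sub>R p ^ 2) * inverse (bergman_den x s p) ^ 3)"

definition fueter_snd :: "real \<Rightarrow> real \<Rightarrow> 'a::real_normed_div_algebra \<Rightarrow> 'a" where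
  "fueter_snd x s p = (16 / pi) *\<^sub>R (p ^ 3 * (1 - x *\<^sub>R p) * inverse (bergman_den x s p) ^ 3)"

definition ball_kernel :: "quat \<Rightarrow> quat \<Rightarrow> quat" where
  "ball_kernel q p = kernel_fst (qRe q) ((norm q)\<^sup>2) p + qcnj q * kernel_snd (qRe q) ((norm q)\<^sup>2) p"

definition ball_fueter_kernel :: "quat \<Rightarrow> quat \<Rightarrow> quat" where
  "ball_fueter_kernel q p = fueter_fst (qRe q) ((norm q)\<^sup>2) p + qcnj q * fueter_snd (qRe q) ((norm q)\<^sup>2) p"

text \<open>The formulas have real coefficients and so commute with any embedding of the complex
  numbers. This is why they are polymorphic: the same definition is used in the complex numbers,
  where products commute, and in the quaternions.\<close>

lemma slice_embed_bergman:
  assumes "j \<in> imag_sphere"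
  shows "slice_embed j (bergman_den x s w) = bergman_den x s (slice_embed j w)"
    and "slice_embed j (kernel_fst x s w) = kernel_fst x s (slice_embed j w)"
    and "slice_embed j (kernel_snd x s w) = kernel_snd x s (slice_embed j w)"
    and "slice_embed j (fueter_fst x s w) = fueter_fst x s (slice_embed j w)"
    and "slice_embed j (fueter_snd x s w) = fueter_snd x s (slice_embed j w)"
  by (simp_all only: bergman_den_def kernel_fst_def kernel_snd_def fueter_fst_def fueter_snd_def
      slice_embed_hom slice_embed_1 slice_embed_numeral assms)

lemma bergman_den_factor:
  "bergman_den (Re z) ((norm z)\<^sup>2) w = (1 - z * w) * (1 - cnj z * w)"
proof -
  have "(1 - z * w) * (1 - cnj z * w) = 1 - (z + cnj z) * w + (z * cnj z) * w ^ 2"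
    by (simp add: algebra_simps power2_eq_square)
  then show ?thesis
    by (simp add: bergman_den_def scaleR_conv_of_real complex_add_cnj
        del: of_real_power flip: complex_norm_square)
qed

lemma one_minus_mult_nonzero:
  fixes z w :: complex
  assumes "norm z < 1" "norm w < 1"
  shows "1 - z * w \<noteq> 0"
  using norm_disc_mult_less[OF assms] by auto

text \<open>The denominator sees only the real part and the norm of q, so q may be replaced by a
  complex number z of the unit disc. Then it factors as (1 - z w)(1 - conj(z) w).\<close>

lemma bergman_den_nonzero:
  fixes w :: complex
  assumes "q \<in> quat_ball" "norm w < 1"
  shows "bergman_den (qRe q) ((norm q)\<^sup>2) w \<noteq> 0"
proof -
  obtain i z where iz: "i \<in> imag_sphere" "q = slice_embed i z" by (rule slice_embed_surj)
  then have "norm z < 1" using assms(1) by (simp add: norm_slice_embed)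
  moreover have "qRe q = Re z" "norm q = norm z" using iz by (simp_all add: slice_embed_sel norm_slice_embed)
  ultimately show ?thesis
    using assms(2) one_minus_mult_nonzero[of z w] one_minus_mult_nonzero[of "cnj z" w]
    by (simp add: bergman_den_factor)
qed

section \<open>Differentiating the coefficients as complex functions of x and s\<close>

text \<open>The counterpart of \<open>has_axial_partials\<close> before embedding into a slice:
  values are complex, hence commute, so product rules stay simple and polynomial identities can be
  decided.\<close>

definition has_complex_partials ::
  "quat set \<Rightarrow> (quat \<Rightarrow> complex) \<Rightarrow> (quat \<Rightarrow> complex) \<Rightarrow> (quat \<Rightarrow> complex) \<Rightarrow> bool" where
  "has_complex_partials S g gx gs \<longleftrightarrow>
     (\<forall>q\<in>S. (g has_derivative (\<lambda>h. of_real (qRe h) * gx q + of_real (2 * (q \<bullet> h)) * gs q)) (at q))"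

lemma has_axial_partials_slice_embed:
  assumes "has_complex_partials S g gx gs"
  shows "has_axial_partials S (\<lambda>q. slice_embed j (g q)) (\<lambda>q. slice_embed j (gx q)) (\<lambda>q. slice_embed j (gs q))"
  unfolding has_axial_partials_def
proof
  fix q assume "q \<in> S"
  with assms have "(g has_derivative (\<lambda>h. qRe h *\<^sub>R gx q + (2 * (q \<bullet> h)) *\<^sub>R gs q)) (at q)"
    by (simp add: has_complex_partials_def scaleR_conv_of_real)
  then have "((\<lambda>q. slice_embed j (g q)) has_derivative
      (\<lambda>h. slice_embed j (qRe h *\<^sub>R gx q + (2 * (q \<bullet> h)) *\<^sub>R gs q))) (at q)"
    by (rule bounded_linear.has_derivative[OF bounded_linear_slice_embed])
  then show "((\<lambda>q. slice_embed j (g q)) has_derivative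
      (\<lambda>h. qRe h *\<^sub>R slice_embed j (gx q) + (2 * (q \<bullet> h)) *\<^sub>R slice_embed j (gs q))) (at q)"
    by (simp only: slice_embed_add slice_embed_scaleR)
qed

lemma has_complex_partials_const: "has_complex_partials S (\<lambda>q. c) (\<lambda>q. 0) (\<lambda>q. 0)"
  by (simp add: has_complex_partials_def)

lemma has_complex_partials_qRe: "has_complex_partials S (\<lambda>q. of_real (qRe q)) (\<lambda>q. 1) (\<lambda>q. 0)"
  by (auto simp: has_complex_partials_def intro!: derivative_eq_intros)

lemma has_complex_partials_norm: "has_complex_partials S (\<lambda>q. of_real ((norm q)\<^sup>2)) (\<lambda>q. 0) (\<lambda>q. 1)"
  unfolding has_complex_partials_def
proof
  fix q :: quat
  have "((\<lambda>q :: quat. q \<bullet> q) has_derivative (\<lambda>h. 2 * (q \<bullet> h))) (at q)"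
    by (auto intro!: derivative_eq_intros simp: inner_commute)
  from has_derivative_of_real[OF this]
  show "((\<lambda>q. of_real ((norm q)\<^sup>2)) has_derivative
      (\<lambda>h. of_real (qRe h) * 0 + of_real (2 * (q \<bullet> h)) * (1 :: complex))) (at q)"
    by (simp add: power2_norm_eq_inner)
qed

lemma has_complex_partials_add:
  "has_complex_partials S f fx fs \<Longrightarrow> has_complex_partials S g gx gs \<Longrightarrow>
   has_complex_partials S (\<lambda>q. f q + g q) (\<lambda>q. fx q + gx q) (\<lambda>q. fs q + gs q)"
  by (auto simp: has_complex_partials_def algebra_simps intro!: derivative_eq_intros)

lemma has_complex_partials_mult:
  "has_complex_partials S f fx fs \<Longrightarrow> has_complex_partials S g gx gs \<Longrightarrow>
   has_complex_partials S (\<lambda>q. f q * g q) (\<lambda>q. fx q * g q + f q * gx q) (\<lambda>q. fs q * g q + f q * gs q)"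
  by (auto simp: has_complex_partials_def algebra_simps intro!: derivative_eq_intros)

lemma has_complex_partials_diff:
  "has_complex_partials S f fx fs \<Longrightarrow> has_complex_partials S g gx gs \<Longrightarrow>
   has_complex_partials S (\<lambda>q. f q - g q) (\<lambda>q. fx q - gx q) (\<lambda>q. fs q - gs q)"
  by (auto simp: has_complex_partials_def algebra_simps intro!: derivative_eq_intros)

lemma has_complex_partials_power:
  assumes "has_complex_partials S f fx fs"
  shows "has_complex_partials S (\<lambda>q. f q ^ n) (\<lambda>q. of_nat n * f q ^ (n - 1) * fx q) (\<lambda>q. of_nat n * f q ^ (n - 1) * fs q)"
  using assms
  by (auto simp: has_complex_partials_def algebra_simps intro!: derivative_eq_intros)

text \<open>The denominator has the partial derivatives -2 w and w^2. Hence differentiation never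
  leaves the polynomials in x, s, w and the inverse of the denominator.\<close>

lemma has_complex_partials_inverse_den:
  assumes "norm w < 1"
  shows "has_complex_partials quat_ball (\<lambda>q. inverse (bergman_den (qRe q) ((norm q)\<^sup>2) w))
    (\<lambda>q. 2 * w * inverse (bergman_den (qRe q) ((norm q)\<^sup>2) w) ^ 2)
    (\<lambda>q. - (w ^ 2) * inverse (bergman_den (qRe q) ((norm q)\<^sup>2) w) ^ 2)"
proof -
  have eq: "bergman_den (qRe q) ((norm q)\<^sup>2) w = 1 - 2 * of_real (qRe q) * w + of_real ((norm q)\<^sup>2) * w ^ 2" for q :: quat
    by (simp add: bergman_den_def scaleR_conv_of_real)
  \<comment> \<open>The zeros and ones are left in place because this is literally the output of the
    sum and product rules.\<close>
  have "has_complex_partials quat_ball (\<lambda>q. bergman_den (qRe q) ((norm q)\<^sup>2) w)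
      (\<lambda>q. 0 - ((0 * of_real (qRe q) + 2 * 1) * w + 2 * of_real (qRe q) * 0) + (0 * w ^ 2 + of_real ((norm q)\<^sup>2) * 0))
      (\<lambda>q. 0 - ((0 * of_real (qRe q) + 2 * 0) * w + 2 * of_real (qRe q) * 0) + (1 * w ^ 2 + of_real ((norm q)\<^sup>2) * 0))"
    unfolding eq
    by (intro has_complex_partials_add has_complex_partials_diff has_complex_partials_mult
        has_complex_partials_const has_complex_partials_qRe has_complex_partials_norm)
  then show ?thesis
    using bergman_den_nonzero[OF _ assms]
    by (auto simp: has_complex_partials_def power2_eq_square algebra_simps intro!: derivative_eq_intros)
qed

text \<open>Separates building a derivative by the calculus rules from identifying it with a
  prescribed expression.\<close>

lemma has_complex_partials_cong:
  assumes "has_complex_partials S f fx fs" "\<And>q. fx q = gx q" "\<And>q. fs q = gs q"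
  shows "has_complex_partials S f gx gs"
  using assms by (simp add: has_complex_partials_def)

context
  fixes w :: complex
  assumes w: "norm w < 1"
begin

abbreviation (input) X :: "quat \<Rightarrow> complex" where "X q \<equiv> of_real (qRe q)"
abbreviation (input) N :: "quat \<Rightarrow> complex" where "N q \<equiv> of_real ((norm q)\<^sup>2)"
abbreviation (input) V :: "quat \<Rightarrow> complex" where "V q \<equiv> inverse (bergman_den (qRe q) ((norm q)\<^sup>2) w)"

lemmas has_complex_partials_intros = has_complex_partials_add has_complex_partials_diff has_complex_partials_mult has_complex_partials_power
  has_complex_partials_const has_complex_partials_qRe has_complex_partials_norm has_complex_partials_inverse_den[OF w]

text \<open>The one relation between \<open>X\<close>, \<open>N\<close> and \<open>V\<close>. Modulo
  it the required identities are polynomial and within reach of \<open>algebra\<close>.\<close>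

lemma inverse_den_mult_den:
  assumes "q \<in> quat_ball"
  shows "V q * (1 - 2 * X q * w + N q * w ^ 2) = 1"
  using bergman_den_nonzero[OF assms w]
  by (simp add: bergman_den_def scaleR_conv_of_real)

text \<open>The first and second derivatives in the shape that \<open>qlaplacian_axial\<close>
  expects: the mixed derivative is the same term in the second and in the third part. The factor
  \<open>c\<close> will be 1/pi.\<close>

lemma kernel_fst_partials:
  fixes c :: complex
  shows "has_complex_partials quat_ball (\<lambda>q. c * ((1 - N q * w\<^sup>2) * V q ^ 2))
      (\<lambda>q. c * (4 * w * (1 - N q * w\<^sup>2) * V q ^ 3))
      (\<lambda>q. c * (- w\<^sup>2 * V q ^ 2 - 2 * w\<^sup>2 * (1 - N q * w\<^sup>2) * V q ^ 3))"
    and "has_complex_partials quat_ball (\<lambda>q. c * (4 * w * (1 - N q * w\<^sup>2) * V q ^ 3))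
      (\<lambda>q. c * (24 * w ^ 2 * (1 - N q * w\<^sup>2) * V q ^ 4))
      (\<lambda>q. c * (- 4 * w ^ 3 * V q ^ 3 - 12 * w ^ 3 * (1 - N q * w\<^sup>2) * V q ^ 4))"
    and "has_complex_partials quat_ball (\<lambda>q. c * (- w\<^sup>2 * V q ^ 2 - 2 * w\<^sup>2 * (1 - N q * w\<^sup>2) * V q ^ 3))
      (\<lambda>q. c * (- 4 * w ^ 3 * V q ^ 3 - 12 * w ^ 3 * (1 - N q * w\<^sup>2) * V q ^ 4))
      (\<lambda>q. c * (4 * w ^ 4 * V q ^ 3 + 6 * w ^ 4 * (1 - N q * w\<^sup>2) * V q ^ 4))"
  by (rule has_complex_partials_cong, (rule has_complex_partials_intros)+, (simp, algebra)+)+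

lemma kernel_snd_partials:
  fixes c :: complex
  shows "has_complex_partials quat_ball (\<lambda>q. c * (- 2 * w * (1 - X q * w) * V q ^ 2))
      (\<lambda>q. c * (2 * w\<^sup>2 * V q ^ 2 - 8 * w\<^sup>2 * (1 - X q * w) * V q ^ 3))
      (\<lambda>q. c * (4 * w ^ 3 * (1 - X q * w) * V q ^ 3))"
    and "has_complex_partials quat_ball (\<lambda>q. c * (2 * w\<^sup>2 * V q ^ 2 - 8 * w\<^sup>2 * (1 - X q * w) * V q ^ 3))
      (\<lambda>q. c * (16 * w ^ 3 * V q ^ 3 - 48 * w ^ 3 * (1 - X q * w) * V q ^ 4))
      (\<lambda>q. c * (- 4 * w ^ 4 * V q ^ 3 + 24 * w ^ 4 * (1 - X q * w) * V q ^ 4))"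
    and "has_complex_partials quat_ball (\<lambda>q. c * (4 * w ^ 3 * (1 - X q * w) * V q ^ 3))
      (\<lambda>q. c * (- 4 * w ^ 4 * V q ^ 3 + 24 * w ^ 4 * (1 - X q * w) * V q ^ 4))
      (\<lambda>q. c * (- 12 * w ^ 5 * (1 - X q * w) * V q ^ 4))"
  by (rule has_complex_partials_cong, (rule has_complex_partials_intros)+, (simp, algebra)+)+

lemma fueter_partials:
  fixes c :: complex
  shows "has_complex_partials quat_ball (\<lambda>q. c * (- 4 * w ^ 2 * (3 - 2 * X q * w - N q * w\<^sup>2) * V q ^ 3))
      (\<lambda>q. c * (8 * w ^ 3 * V q ^ 3 - 24 * w ^ 3 * (3 - 2 * X q * w - N q * w\<^sup>2) * V q ^ 4))
      (\<lambda>q. c * (4 * w ^ 4 * V q ^ 3 + 12 * w ^ 4 * (3 - 2 * X q * w - N q * w\<^sup>2) * V q ^ 4))"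
    and "has_complex_partials quat_ball (\<lambda>q. c * (16 * w ^ 3 * (1 - X q * w) * V q ^ 3))
      (\<lambda>q. c * (- 16 * w ^ 4 * V q ^ 3 + 96 * w ^ 4 * (1 - X q * w) * V q ^ 4))
      (\<lambda>q. c * (- 48 * w ^ 5 * (1 - X q * w) * V q ^ 4))"
  by (rule has_complex_partials_cong, (rule has_complex_partials_intros)+, (simp, algebra)+)+

lemma kernel_coefficients_eq:
  "kernel_fst (qRe q) ((norm q)\<^sup>2) w = of_real (1 / pi) * ((1 - N q * w\<^sup>2) * V q ^ 2)"
  "kernel_snd (qRe q) ((norm q)\<^sup>2) w = of_real (1 / pi) * (- 2 * w * (1 - X q * w) * V q ^ 2)"
  "fueter_fst (qRe q) ((norm q)\<^sup>2) w = of_real (1 / pi) * (- 4 * w ^ 2 * (3 - 2 * X q * w - N q * w\<^sup>2) * V q ^ 3)"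
  "fueter_snd (qRe q) ((norm q)\<^sup>2) w = of_real (1 / pi) * (16 * w ^ 3 * (1 - X q * w) * V q ^ 3)"
  by (simp_all add: kernel_fst_def kernel_snd_def fueter_fst_def fueter_snd_def scaleR_conv_of_real)

lemma ball_kernel_differentiable:
  assumes j: "j \<in> imag_sphere" and q: "q \<in> quat_ball"
  shows "(\<lambda>q. ball_kernel q (slice_embed j w)) differentiable (at q)"
proof (rule differentiable_axial[OF open_ball q
    kernel_fst_partials(1)[where c = "of_real (1 / pi)", THEN has_axial_partials_slice_embed[where j = j]]
    kernel_snd_partials(1)[where c = "of_real (1 / pi)", THEN has_axial_partials_slice_embed[where j = j]]])
  show "ball_kernel q (slice_embed j w) = slice_embed j (of_real (1 / pi) * ((1 - N q * w\<^sup>2) * V q ^ 2)) +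
      qcnj q * slice_embed j (of_real (1 / pi) * (- 2 * w * (1 - X q * w) * V q ^ 2))" for q
    by (simp only: ball_kernel_def slice_embed_bergman[OF j, symmetric] kernel_coefficients_eq)
qed

theorem qlaplacian_ball_kernel:
  assumes j: "j \<in> imag_sphere" and q: "q \<in> quat_ball"
    and F: "\<And>q. q \<in> quat_ball \<Longrightarrow> F q = ball_kernel q (slice_embed j w)"
  shows "qlaplacian F q = ball_fueter_kernel q (slice_embed j w)"
proof -
  let ?c = "of_real (1 / pi) :: complex"
  have F': "F q = slice_embed j (?c * ((1 - N q * w\<^sup>2) * V q ^ 2)) +
      qcnj q * slice_embed j (?c * (- 2 * w * (1 - X q * w) * V q ^ 2))" if "q \<in> quat_ball" for q
    unfolding F[OF that] ball_kernel_def by (simp only: slice_embed_bergman[OF j, symmetric] kernel_coefficients_eq)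
  have V: "V q * (1 - 2 * X q * w + N q * w ^ 2) = 1" by (rule inverse_den_mult_den[OF q])
  \<comment> \<open>Facts \<open>1\<close> and \<open>2\<close> are the parts of
    \<open>qlaplacian_axial\<close> without and with the left factor conj(q). In each, the terms in
    \<open>V q ^ 4\<close> contain the denominator as a factor and so drop to
    \<open>V q ^ 3\<close>; the terms in \<open>V q ^ 2\<close> are lifted to that power by the same
    relation.\<close>
  have 1: "c * (24 * w ^ 2 * (1 - N q * w\<^sup>2) * V q ^ 4) +
      (4 * qRe q) *\<^sub>R (c * (- 4 * w ^ 3 * V q ^ 3 - 12 * w ^ 3 * (1 - N q * w\<^sup>2) * V q ^ 4)) +
      (4 * (norm q)\<^sup>2) *\<^sub>R (c * (4 * w ^ 4 * V q ^ 3 + 6 * w ^ 4 * (1 - N q * w\<^sup>2) * V q ^ 4)) +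
      8 *\<^sub>R (c * (- w\<^sup>2 * V q ^ 2 - 2 * w\<^sup>2 * (1 - N q * w\<^sup>2) * V q ^ 3)) +
      2 *\<^sub>R (c * (2 * w\<^sup>2 * V q ^ 2 - 8 * w\<^sup>2 * (1 - X q * w) * V q ^ 3)) =
      c * (- 4 * w ^ 2 * (3 - 2 * X q * w - N q * w\<^sup>2) * V q ^ 3)" for c
    unfolding scaleR_conv_of_real of_real_mult of_real_numeral using V by algebra
  have 2: "c * (16 * w ^ 3 * V q ^ 3 - 48 * w ^ 3 * (1 - X q * w) * V q ^ 4) +
      (4 * qRe q) *\<^sub>R (c * (- 4 * w ^ 4 * V q ^ 3 + 24 * w ^ 4 * (1 - X q * w) * V q ^ 4)) +
      (4 * (norm q)\<^sup>2) *\<^sub>R (c * (- 12 * w ^ 5 * (1 - X q * w) * V q ^ 4)) +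
      12 *\<^sub>R (c * (4 * w ^ 3 * (1 - X q * w) * V q ^ 3)) =
      c * (16 * w ^ 3 * (1 - X q * w) * V q ^ 3)" for c
    unfolding scaleR_conv_of_real of_real_mult of_real_numeral using V by algebra
  have "qlaplacian F q = slice_embed j (?c * (- 4 * w ^ 2 * (3 - 2 * X q * w - N q * w\<^sup>2) * V q ^ 3)) +
      qcnj q * slice_embed j (?c * (16 * w ^ 3 * (1 - X q * w) * V q ^ 3))"
  proof (rule trans[OF qlaplacian_axial[OF open_ball q
        kernel_fst_partials[where c = ?c, THEN has_axial_partials_slice_embed]
        kernel_snd_partials[where c = ?c, THEN has_axial_partials_slice_embed]]])
    show "F q = slice_embed j (?c * ((1 - N q * w\<^sup>2) * V q ^ 2)) +
      qcnj q * slice_embed j (?c * (- 2 * w * (1 - X q * w) * V q ^ 2))" if "q \<in> quat_ball" for q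
      using F'[OF that] .
  qed (simp only: 1[symmetric] 2[symmetric] slice_embed_add slice_embed_scaleR)
  then show ?thesis
    by (simp only: ball_fueter_kernel_def slice_embed_bergman[OF j, symmetric] kernel_coefficients_eq)
qed

lemma fueter_regular_ball_fueter_kernel:
  assumes j: "j \<in> imag_sphere"
    and F: "\<And>q. q \<in> quat_ball \<Longrightarrow> F q = ball_fueter_kernel q (slice_embed j w)"
  shows "fueter_regular_on quat_ball F"
proof -
  let ?c = "of_real (1 / pi) :: complex"
  note partials = fueter_partials[where c = ?c, THEN has_axial_partials_slice_embed[where j = j]]
  have F': "F q = slice_embed j (?c * (- 4 * w ^ 2 * (3 - 2 * X q * w - N q * w\<^sup>2) * V q ^ 3)) +
      qcnj q * slice_embed j (?c * (16 * w ^ 3 * (1 - X q * w) * V q ^ 3))" if "q \<in> quat_ball" for q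
    unfolding F[OF that] ball_fueter_kernel_def
    by (simp only: slice_embed_bergman[OF j, symmetric] kernel_coefficients_eq)
  have "qpartial 1 F q + quat_ii * qpartial quat_ii F q + quat_jj * qpartial quat_jj F q
      + quat_kk * qpartial quat_kk F q = 0" if q: "q \<in> quat_ball" for q
  proof (rule trans[OF fueter_axial[OF open_ball q partials]])
    have V: "V q * (1 - 2 * X q * w + N q * w ^ 2) = 1" by (rule inverse_den_mult_den[OF q])
    \<comment> \<open>In both identities the terms in \<open>V q ^ 4\<close> add up to a multiple of
      the denominator; lowered to \<open>V q ^ 3\<close> they cancel the remaining terms.\<close>
    have 1: "c * (8 * w ^ 3 * V q ^ 3 - 24 * w ^ 3 * (3 - 2 * X q * w - N q * w\<^sup>2) * V q ^ 4) +
        (4 * qRe q) *\<^sub>R (c * (4 * w ^ 4 * V q ^ 3 + 12 * w ^ 4 * (3 - 2 * X q * w - N q * w\<^sup>2) * V q ^ 4)) +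
        4 *\<^sub>R (c * (16 * w ^ 3 * (1 - X q * w) * V q ^ 3)) +
        (2 * (norm q)\<^sup>2) *\<^sub>R (c * (- 48 * w ^ 5 * (1 - X q * w) * V q ^ 4)) = 0" for c
      unfolding scaleR_conv_of_real of_real_mult of_real_numeral using V by algebra
    have 2: "c * (- 16 * w ^ 4 * V q ^ 3 + 96 * w ^ 4 * (1 - X q * w) * V q ^ 4) -
        2 *\<^sub>R (c * (4 * w ^ 4 * V q ^ 3 + 12 * w ^ 4 * (3 - 2 * X q * w - N q * w\<^sup>2) * V q ^ 4)) = 0" for c
      unfolding scaleR_conv_of_real of_real_mult of_real_numeral using V by algebra
    show "slice_embed j (?c * (8 * w ^ 3 * V q ^ 3 - 24 * w ^ 3 * (3 - 2 * X q * w - N q * w\<^sup>2) * V q ^ 4)) +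
        (4 * qRe q) *\<^sub>R slice_embed j (?c * (4 * w ^ 4 * V q ^ 3 + 12 * w ^ 4 * (3 - 2 * X q * w - N q * w\<^sup>2) * V q ^ 4)) +
        4 *\<^sub>R slice_embed j (?c * (16 * w ^ 3 * (1 - X q * w) * V q ^ 3)) +
        (2 * (norm q)\<^sup>2) *\<^sub>R slice_embed j (?c * (- 48 * w ^ 5 * (1 - X q * w) * V q ^ 4)) +
        qcnj q * (slice_embed j (?c * (- 16 * w ^ 4 * V q ^ 3 + 96 * w ^ 4 * (1 - X q * w) * V q ^ 4)) -
          2 *\<^sub>R slice_embed j (?c * (4 * w ^ 4 * V q ^ 3 + 12 * w ^ 4 * (3 - 2 * X q * w - N q * w\<^sup>2) * V q ^ 4))) = 0"
      unfolding slice_embed_add[symmetric] slice_embed_diff[symmetric] slice_embed_scaleR[symmetric] 1 2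
      by simp
  qed (rule F')
  moreover have "F differentiable_on quat_ball"
    unfolding differentiable_on_def
  proof
    show "F differentiable (at q within quat_ball)" if "q \<in> quat_ball" for q
      by (rule differentiable_at_withinI, rule differentiable_axial[OF open_ball that partials], rule F')
  qed
  ultimately show ?thesis by (simp add: fueter_regular_on_def)
qed

end

section \<open>The representation formula and slice regularity of the closed form\<close>

text \<open>With the second variable already conjugated, the kernel is holomorphic and symmetric in
  its two arguments.\<close>

definition disc_kernel :: "complex \<Rightarrow> complex \<Rightarrow> complex" where
  "disc_kernel z w = 1 / (of_real pi * (1 - z * w)\<^sup>2)"

text \<open>The origin of the closed form: expand the fraction 1 / (1 - z w)^2 by (1 - conj(z) w)^2,
  which makes the denominator real in z, and reduce conj(z)^2 to 2 Re(z) conj(z) - |z|^2 in the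
  numerator.\<close>

lemma disc_kernel_eq:
  assumes "norm z < 1" "norm w < 1"
  shows "disc_kernel z w = kernel_fst (Re z) ((norm z)\<^sup>2) w + cnj z * kernel_snd (Re z) ((norm z)\<^sup>2) w"
proof -
  have nz: "1 - z * w \<noteq> 0" "1 - cnj z * w \<noteq> 0"
    using assms one_minus_mult_nonzero[of z w] one_minus_mult_nonzero[of "cnj z" w] by auto
  have x: "of_real (Re z) = (z + cnj z) / 2"
    by (simp add: complex_add_cnj)
  have "kernel_fst (Re z) ((norm z)\<^sup>2) w + cnj z * kernel_snd (Re z) ((norm z)\<^sup>2) w =
      ((1 - of_real ((norm z)\<^sup>2) * w\<^sup>2) - 2 * cnj z * w * (1 - of_real (Re z) * w)) *
        inverse ((1 - z * w) * (1 - cnj z * w)) ^ 2 / of_real pi"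
    by (simp only: kernel_fst_def kernel_snd_def bergman_den_factor scaleR_conv_of_real)
       (simp add: algebra_simps add_divide_distrib diff_divide_distrib)
  also have "(1 - of_real ((norm z)\<^sup>2) * w\<^sup>2) - 2 * cnj z * w * (1 - of_real (Re z) * w) = (1 - cnj z * w)\<^sup>2"
    unfolding x complex_norm_square by (simp add: field_simps power2_eq_square)
  also have "(1 - cnj z * w)\<^sup>2 * inverse ((1 - z * w) * (1 - cnj z * w)) ^ 2 / of_real pi = disc_kernel z w"
  proof -
    have "v\<^sup>2 * inverse (u * v) ^ 2 / c = 1 / (c * u\<^sup>2)" if "u \<noteq> 0" "v \<noteq> 0" for u v c :: complex
      using that by (simp add: field_simps power_mult_distrib)
    from this[OF nz] show ?thesis by (simp only: disc_kernel_def)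
  qed
  finally show ?thesis by simp
qed

text \<open>The coefficients of \<open>ball_kernel\<close> agree at z and conj(z) and do not depend
  on the unit of q. The representation formula is therefore an identity for P + (x - y i) R,
  following from j^2 = -1 alone.\<close>

lemma ball_kernel_slices:
  assumes i: "i \<in> imag_sphere" and j: "j \<in> imag_sphere" and "norm z < 1" "norm w < 1"
  shows "ball_kernel (slice_embed i z) (slice_embed j w) =
    (1/2) *\<^sub>R ((1 - i * j) * slice_embed j (disc_kernel z w)) +
    (1/2) *\<^sub>R ((1 + i * j) * slice_embed j (disc_kernel (cnj z) w))"
proof -
  let ?a = "kernel_fst (Re z) ((norm z)\<^sup>2) w" and ?b = "kernel_snd (Re z) ((norm z)\<^sup>2) w"
  define P R where "P = slice_embed j ?a" and "R = slice_embed j ?b"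
  have jj: "j * (j * t) = - t" for t
    by (simp add: imag_sphereD[OF j] flip: mult.assoc)
  have 1: "disc_kernel z w = ?a + cnj z * ?b" "disc_kernel (cnj z) w = ?a + z * ?b"
    using disc_kernel_eq[of z w] disc_kernel_eq[of "cnj z" w] assms by simp_all
  have e: "slice_embed j z = Re z *\<^sub>R 1 + Im z *\<^sub>R j" "slice_embed j (cnj z) = Re z *\<^sub>R 1 - Im z *\<^sub>R j"
      "slice_embed i (cnj z) = Re z *\<^sub>R 1 - Im z *\<^sub>R i"
    by (simp_all add: slice_embed_def slice_point_def of_real_def)
  have "(1 - i * j) * (P + (Re z *\<^sub>R 1 - Im z *\<^sub>R j) * R) + (1 + i * j) * (P + (Re z *\<^sub>R 1 + Im z *\<^sub>R j) * R) =
      2 *\<^sub>R (P + (Re z *\<^sub>R 1 - Im z *\<^sub>R i) * R)"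
    by (simp add: algebra_simps jj) (simp add: quat_eq_iff)
  then have "(1/2) *\<^sub>R ((1 - i * j) * (P + (Re z *\<^sub>R 1 - Im z *\<^sub>R j) * R)) +
      (1/2) *\<^sub>R ((1 + i * j) * (P + (Re z *\<^sub>R 1 + Im z *\<^sub>R j) * R)) =
      P + (Re z *\<^sub>R 1 - Im z *\<^sub>R i) * R"
    by (simp flip: scaleR_add_right)
  moreover have "ball_kernel (slice_embed i z) (slice_embed j w) = P + (Re z *\<^sub>R 1 - Im z *\<^sub>R i) * R"
    by (simp add: ball_kernel_def slice_embed_sel[OF i] norm_slice_embed[OF i] qcnj_slice_embed[OF i] e
        P_def R_def slice_embed_bergman[OF j])
  ultimately show ?thesis
    by (simp only: 1 slice_embed_add slice_embed_mult[OF j] e P_def R_def)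
qed

lemma ball_kernel_same_slice:
  assumes j: "j \<in> imag_sphere" and "norm z < 1" "norm w < 1"
  shows "ball_kernel (slice_embed j z) (slice_embed j w) = slice_embed j (disc_kernel z w)"
  unfolding ball_kernel_slices[OF j assms] imag_sphereD[OF j] by (simp flip: mult_2)

lemma disc_kernel_has_field_derivative:
  assumes "norm z < 1" "norm w < 1"
  shows "((\<lambda>z. disc_kernel z w) has_field_derivative 2 * w / (of_real pi * (1 - z * w) ^ 3)) (at z)"
  unfolding disc_kernel_def using one_minus_mult_nonzero[OF assms]
  by (auto intro!: derivative_eq_intros simp: divide_simps power2_eq_square power3_eq_cube)

lemma norm_disc_kernel_le:
  assumes "norm z \<le> 1" "norm w < 1"
  shows "norm (disc_kernel z w) \<le> 1 / (pi * (1 - norm w)\<^sup>2)"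
proof -
  \<comment> \<open>The roles are exchanged: here w is the interior point and z may lie on the
    boundary.\<close>
  have "norm (1 / (1 - w * cnj (cnj z))\<^sup>2) \<le> 1 / (1 - norm w)\<^sup>2"
    using assms by (intro bergman_denominator_bound) auto
  then have "(1 / pi) * norm (1 / (1 - w * cnj (cnj z))\<^sup>2) \<le> (1 / pi) * (1 / (1 - norm w)\<^sup>2)"
    by (intro mult_left_mono) auto
  then show ?thesis
    by (simp add: disc_kernel_def norm_divide norm_mult norm_power mult.commute)
qed

lemma slice_embed_has_derivative:
  assumes "(h has_field_derivative h') (at z)"
  shows "((\<lambda>z. slice_embed j (h z)) has_derivative (\<lambda>k. slice_embed j (h' * k))) (at z)"
  using bounded_linear.has_derivative[OF bounded_linear_slice_embed] assms
  by (auto simp: has_field_derivative_def)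

lemma slice_embed_cnj_has_derivative:
  assumes "(h has_field_derivative h') (at (cnj z))"
  shows "((\<lambda>z. slice_embed j (h (cnj z))) has_derivative (\<lambda>k. slice_embed j (h' * cnj k))) (at z)"
proof -
  have "(h has_derivative (*) h') (at (cnj z))"
    using assms by (simp add: has_field_derivative_def)
  from has_derivative_compose[OF bounded_linear.has_derivative[OF bounded_linear_cnj has_derivative_ident] this]
  show ?thesis by (intro bounded_linear.has_derivative[OF bounded_linear_slice_embed])
qed

text \<open>Both partial derivatives on a slice are values of one real derivative \<open>D\<close>,
  so the slice equations become conditions on \<open>D\<close> at 1 and at the imaginary
  unit.\<close>

lemma slice_partials:
  assumes G: "(G has_derivative D) (at z)" and z: "norm z < 1"
    and f: "\<And>z. norm z < 1 \<Longrightarrow> f (slice_embed i z) = G z"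
  shows "slice_dx f i (Re z) (Im z) = D 1" and "slice_dy f i (Re z) (Im z) = D \<i>"
proof -
  have F: "((\<lambda>z. f (slice_embed i z)) has_derivative D) (at z)"
    by (rule has_derivative_transform_within_open[OF G open_ball[of 0 1]]) (use z f in auto)
  then have lin: "D (t *\<^sub>R k) = t *\<^sub>R D k" for t k
    by (simp add: has_derivative_def linear_simps)
  have px: "((\<lambda>t. Complex t (Im z)) has_derivative (\<lambda>t. t *\<^sub>R 1)) (at (Re z))"
    and py: "((\<lambda>t. Complex (Re z) t) has_derivative (\<lambda>t. t *\<^sub>R \<i>)) (at (Im z))"
    unfolding Complex_eq by (auto intro!: derivative_eq_intros simp: scaleR_conv_of_real)
  show "slice_dx f i (Re z) (Im z) = D 1"
    using has_derivative_compose[OF px, of "\<lambda>z. f (slice_embed i z)" D] F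
    by (simp add: slice_dx_def slice_point_eq_slice_embed vector_derivative_at has_vector_derivative_def lin)
  show "slice_dy f i (Re z) (Im z) = D \<i>"
    using has_derivative_compose[OF py, of "\<lambda>z. f (slice_embed i z)" D] F
    by (simp add: slice_dy_def slice_point_eq_slice_embed vector_derivative_at has_vector_derivative_def lin)
qed

text \<open>The factors of the representation formula satisfy i (1 - i j) = (1 - i j) j and i (1 + i
  j) = - (1 + i j) j. Thus left multiplication by i becomes multiplication by j on the holomorphic
  half and by -j on the antiholomorphic half, and both halves satisfy the equation.\<close>

lemma slice_regular_ball_kernel:
  assumes j: "j \<in> imag_sphere" and w: "norm w < 1"
    and f: "\<And>q. q \<in> quat_ball \<Longrightarrow> f q = ball_kernel q (slice_embed j w)"
  shows "slice_regular_on quat_ball f"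
  unfolding slice_regular_on_def
proof (intro conjI ballI allI impI)
  show "f differentiable_on quat_ball"
    unfolding differentiable_on_def
  proof
    fix q :: quat assume q: "q \<in> quat_ball"
    obtain D where "((\<lambda>q. ball_kernel q (slice_embed j w)) has_derivative D) (at q)"
      using ball_kernel_differentiable[OF w j q] by (auto simp: differentiable_def)
    then have "(f has_derivative D) (at q)"
      by (rule has_derivative_transform_within_open[OF _ open_ball q]) (simp add: f)
    then show "f differentiable at q within quat_ball"
      by (rule differentiable_at_withinI[OF differentiableI])
  qed
next
  fix i x y assume i: "i \<in> imag_sphere" and "slice_point i x y \<in> quat_ball"
  then have z: "norm (Complex x y) < 1"
    by (simp add: slice_point_eq_slice_embed norm_slice_embed)
  define h where "h z = 2 * w / (of_real pi * (1 - z * w) ^ 3)" for z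
  have h: "((\<lambda>z. disc_kernel z w) has_field_derivative h z) (at z)" if "norm z < 1" for z
    unfolding h_def by (rule disc_kernel_has_field_derivative[OF that w])
  let ?z = "Complex x y"
  let ?D = "\<lambda>k. (1/2) *\<^sub>R ((1 - i * j) * slice_embed j (h ?z * k)) +
    (1/2) *\<^sub>R ((1 + i * j) * slice_embed j (h (cnj ?z) * cnj k))"
  have D: "((\<lambda>z. (1/2) *\<^sub>R ((1 - i * j) * slice_embed j (disc_kernel z w)) +
    (1/2) *\<^sub>R ((1 + i * j) * slice_embed j (disc_kernel (cnj z) w))) has_derivative ?D) (at ?z)"
    using z by (intro has_derivative_add has_derivative_scaleR_right has_derivative_mult_right
        slice_embed_has_derivative slice_embed_cnj_has_derivative h) auto
  have F: "f (slice_embed i z) = (1/2) *\<^sub>R ((1 - i * j) * slice_embed j (disc_kernel z w)) +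
    (1/2) *\<^sub>R ((1 + i * j) * slice_embed j (disc_kernel (cnj z) w))" if "norm z < 1" for z
    using that by (subst f) (simp_all add: ball_kernel_slices[OF i j that w] norm_slice_embed[OF i])
  define P R where "P = slice_embed j (h ?z)" and "R = slice_embed j (h (cnj ?z))"
  have dx: "slice_dx f i x y = (1/2) *\<^sub>R ((1 - i * j) * P) + (1/2) *\<^sub>R ((1 + i * j) * R)"
    using slice_partials(1)[OF D z F] by (simp add: P_def R_def)
  have dy: "slice_dy f i x y = (1/2) *\<^sub>R ((1 - i * j) * (j * P)) + (1/2) *\<^sub>R ((1 + i * j) * - (j * R))"
    using slice_partials(2)[OF D z F]
    by (simp add: P_def R_def slice_embed_mult[OF j] slice_embed_minus mult.commute[of "h _"])
  have jj: "j * (j * t) = - t" and ii: "i * (i * t) = - t" for t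
    using imag_sphereD(3)[OF i] imag_sphereD(3)[OF j] by (simp_all flip: mult.assoc)
  show "slice_dx f i x y + i * slice_dy f i x y = 0"
    unfolding dx dy by (simp add: algebra_simps jj ii)
qed simp

section \<open>Complex coordinates and the identity principle for slice regular functions\<close>

text \<open>The first coordinate of the quaternions as a left vector space over C(j), which is the
  orthogonal projection onto C(j). Right multiplication by constants before projecting recovers the
  other coordinate.\<close>

definition slice_proj :: "quat \<Rightarrow> quat \<Rightarrow> complex" where
  "slice_proj j q = Complex (qRe q) (q \<bullet> j)"

lemma bounded_linear_slice_proj: "bounded_linear (slice_proj j)"
  by (intro bounded_linearI' linear_conv_bounded_linear[THEN iffD1] linearI)
     (simp_all add: slice_proj_def complex_eq_iff inner_add_left)

lemma slice_proj_slice_embed_mult: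
  assumes "j \<in> imag_sphere"
  shows "slice_proj j (slice_embed j z * q) = z * slice_proj j q"
proof -
  have "j \<bullet> j = 1" using assms by (simp add: imag_sphere_def dot_square_norm)
  have "qIm1 j * (qIm1 j * (Im z * qRe q)) + qIm2 j * (qIm2 j * (Im z * qRe q)) + qIm3 j * (qIm3 j * (Im z * qRe q)) =
      (qIm1 j * qIm1 j + qIm2 j * qIm2 j + qIm3 j * qIm3 j) * (Im z * qRe q)"
    by (simp add: algebra_simps)
  then show ?thesis
    unfolding imag_sphereD(2)[OF assms]
    by (simp add: slice_proj_def complex_eq_iff inner_quat_def slice_embed_sel[OF assms] imag_sphereD(1)[OF assms] algebra_simps)
qed

text \<open>The constant c = conj(a - b) makes the real part of (a - b) c equal to |a -
  b|^2.\<close>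

lemma slice_proj_right_mult_eqD:
  assumes "\<And>c. slice_proj j (a * c) = slice_proj j (b * c)"
  shows "a = b"
proof -
  have "qRe (a * c) = qRe (b * c)" for c
    using assms[of c] by (simp add: slice_proj_def)
  from this[of "qcnj (a - b)"] have "qRe ((a - b) * qcnj (a - b)) = 0"
    by (simp only: left_diff_distrib minus_quat.sel)
  also have "qRe ((a - b) * qcnj (a - b)) = (a - b) \<bullet> (a - b)"
    by (simp add: inner_quat_def algebra_simps)
  finally show ?thesis by simp
qed

text \<open>Slice regularity gives D(i) = i D(1), so the derivative along the slice is left
  multiplication of D(1) by elements of C(i). Right multiplication by c and
  \<open>slice_proj\<close> both respect left multiplication by C(i), hence the result is complex
  differentiable.\<close>

lemma slice_regular_proj_holomorphic:
  assumes f: "slice_regular_on quat_ball f" and i: "i \<in> imag_sphere"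
  shows "(\<lambda>z. slice_proj i (f (slice_embed i z) * c)) holomorphic_on ball 0 1"
proof (rule holomorphic_onI)
  fix z :: complex assume "z \<in> ball 0 1"
  then have z: "norm z < 1" by simp
  have q: "slice_embed i z \<in> quat_ball" using z by (simp add: norm_slice_embed[OF i])
  have "f differentiable (at (slice_embed i z))"
    using f q by (simp add: slice_regular_on_def differentiable_on_def flip: at_within_open[OF q open_ball])
  then obtain D where D: "(f has_derivative D) (at (slice_embed i z))"
    by (auto simp: differentiable_def)
  have G: "((\<lambda>z. f (slice_embed i z)) has_derivative (\<lambda>k. D (slice_embed i k))) (at z)"
    by (rule has_derivative_compose[OF bounded_linear.has_derivative[OF bounded_linear_slice_embed has_derivative_ident] D])
  have "\<forall>x y. slice_point i x y \<in> quat_ball \<longrightarrow> slice_dx f i x y + i * slice_dy f i x y = 0"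
    using f i by (simp add: slice_regular_on_def)
  from this[rule_format, of "Re z" "Im z"] have "D 1 + i * D i = 0"
    using q slice_partials[OF G z, of f i] by (simp add: slice_point_eq_slice_embed)
  then have "i * (D 1 + i * D i) = 0" by simp
  then have Di: "D i = i * D 1"
    using imag_sphereD(3)[OF i] by (simp add: distrib_left flip: mult.assoc)
  have "D (slice_embed i k) = slice_embed i k * D 1" for k
  proof -
    interpret D: bounded_linear D using D by (rule has_derivative_bounded_linear)
    have "slice_embed i k = Re k *\<^sub>R 1 + Im k *\<^sub>R i"
      by (simp add: slice_embed_def slice_point_def of_real_def)
    then show ?thesis by (simp add: D.add D.scaleR Di algebra_simps)
  qed
  then have G': "((\<lambda>z. f (slice_embed i z)) has_derivative (\<lambda>k. slice_embed i k * D 1)) (at z)"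
    using G by simp
  have "((\<lambda>z. slice_proj i (f (slice_embed i z) * c)) has_derivative
      (\<lambda>k. slice_proj i ((slice_embed i k * D 1) * c))) (at z)"
    by (intro bounded_linear.has_derivative[OF bounded_linear_slice_proj] has_derivative_mult_left G')
  then have "((\<lambda>z. slice_proj i (f (slice_embed i z) * c)) has_field_derivative slice_proj i (D 1 * c)) (at z)"
    by (simp add: has_field_derivative_def mult.assoc slice_proj_slice_embed_mult[OF i]
        mult.commute[of _ "slice_proj i (D 1 * c)"])
  then have "(\<lambda>z. slice_proj i (f (slice_embed i z) * c)) field_differentiable at z"
    by (auto simp: field_differentiable_def)
  then show "(\<lambda>z. slice_proj i (f (slice_embed i z) * c)) field_differentiable at z within ball 0 1"
    by (rule field_differentiable_at_within)
qed

text \<open>Every slice contains the real interval (-1, 1), which accumulates at 0. Analytic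
  continuation of the complex coordinates carries equality from there to each slice.\<close>

lemma slice_regular_eq_on_reals:
  assumes f: "slice_regular_on quat_ball f" and g: "slice_regular_on quat_ball g"
    and eq: "\<And>x. \<bar>x\<bar> < 1 \<Longrightarrow> f (of_real x) = g (of_real x)" and q: "q \<in> quat_ball"
  shows "f q = g q"
proof -
  obtain i z where i: "i \<in> imag_sphere" and qz: "q = slice_embed i z" by (rule slice_embed_surj)
  have z: "z \<in> ball 0 1" using q by (simp add: qz norm_slice_embed[OF i])
  have "slice_proj i (f q * c) = slice_proj i (g q * c)" for c
  proof -
    define h where "h z = slice_proj i (f (slice_embed i z) * c) - slice_proj i (g (slice_embed i z) * c)" for z
    have "h z = 0"
    proof (rule analytic_continuation[of h "ball 0 1" "of_real ` {-1<..<1}" 0])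
      show "h holomorphic_on ball 0 1"
        unfolding h_def by (intro holomorphic_intros slice_regular_proj_holomorphic f g i)
      show "(0 :: complex) islimpt of_real ` {-1<..<1 :: real}"
      proof (rule islimpt_sequential[THEN iffD2], intro exI conjI allI)
        have "1 / real (n + 2) \<in> {-1<..<1}" for n
          by (simp add: divide_simps)
        then show "complex_of_real (1 / real (n + 2)) \<in> of_real ` {-1<..<1} - {0}" for n
          by (intro DiffI imageI) (simp_all only: singleton_iff of_real_eq_0_iff, simp_all)
        have "(\<lambda>n. 1 / real (n + 2)) \<longlonglongrightarrow> 0" by real_asymp
        from tendsto_of_real[OF this]
        show "(\<lambda>n. complex_of_real (1 / real (n + 2))) \<longlonglongrightarrow> 0"
          by (simp only: of_real_0)
      qed
    qed (use z eq in \<open>auto simp: h_def\<close>)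
    then show ?thesis by (simp add: h_def qz)
  qed
  then show ?thesis by (rule slice_proj_right_mult_eqD)
qed

section \<open>The representing elements\<close>

lemma continuous_on_slice_embed: "continuous_on S (slice_embed j)"
  by (rule bounded_linear.continuous_on[OF bounded_linear_slice_embed continuous_on_id])

lemma slice_measure_eq_distr: "slice_measure j = distr lborel borel (slice_embed j)"
proof -
  have "(\<lambda>(x, y). Complex x y) \<in> borel_measurable borel"
    by (simp add: borel_measurable_continuous_onI case_prod_unfold Complex_eq continuous_intros)
  moreover have "slice_embed j \<in> borel_measurable borel"
    by (rule borel_measurable_continuous_onI[OF continuous_on_slice_embed])
  ultimately have "distr (distr lborel borel (\<lambda>(x, y). Complex x y)) borel (slice_embed j) =
      distr lborel borel (slice_embed j \<circ> (\<lambda>(x, y). Complex x y))"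
    by (intro distr_distr) simp_all
  moreover have "slice_embed j \<circ> (\<lambda>(x, y). Complex x y) = (\<lambda>(x, y). slice_point j x y)"
    by (simp add: fun_eq_iff slice_point_eq_slice_embed)
  ultimately have "distr (distr lborel borel (\<lambda>(x, y). Complex x y)) borel (slice_embed j) =
      distr lborel borel (\<lambda>(x, y). slice_point j x y)"
    by simp
  then show ?thesis
    by (simp add: slice_measure_def flip: lborel_complex_eq_distr)
qed

lemma slice_embed_mem_slice:
  assumes "j \<in> imag_sphere"
  shows "slice_embed j z \<in> slice quat_ball j \<longleftrightarrow> z \<in> ball 0 1"
  using slice_ball_iff[OF assms, of "slice_embed j z"] by (auto simp: norm_slice_embed[OF assms] slice_def)

lemma slice_ball_borel:
  assumes "j \<in> imag_sphere"
  shows "slice quat_ball j \<in> sets borel"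
proof -
  have "slice_plane j = range (slice_embed j)"
    unfolding slice_plane_def slice_embed_def image_def by (auto intro: exI[where x = "Complex _ _"])
  moreover have "closed (range (slice_embed j))"
    by (intro closed_subspace linear_subspace_image[OF bounded_linear.linear[OF bounded_linear_slice_embed]]) simp
  ultimately show ?thesis by (simp add: slice_def)
qed

lemma slice_set_integral:
  fixes g :: "quat \<Rightarrow> 'b :: {banach, second_countable_topology}"
  assumes j: "j \<in> imag_sphere" and g: "continuous_on quat_ball g"
  shows "(LINT r:slice quat_ball j|slice_measure j. g r) = (LINT z:ball 0 1|lborel. g (slice_embed j z))"
proof -
  \<comment> \<open>The function is continuous on the ball only, so it is cut off there to be Borel
    measurable; on the slice the cutoff changes nothing.\<close>
  have "(\<lambda>r. indicator (slice quat_ball j) r *\<^sub>R (indicator quat_ball r *\<^sub>R g r)) \<in> borel_measurable borel"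
    using slice_ball_borel[OF j] by (intro borel_measurable_scaleR borel_measurable_indicator
        borel_measurable_continuous_on_indicator g) auto
  also have "(\<lambda>r. indicator (slice quat_ball j) r *\<^sub>R (indicator quat_ball r *\<^sub>R g r)) =
      (\<lambda>r. indicator (slice quat_ball j) r *\<^sub>R g r)"
    by (auto simp: indicator_def slice_def)
  finally show ?thesis
    unfolding set_lebesgue_integral_def slice_measure_eq_distr
    by (subst integral_distr)
       (auto simp: indicator_def slice_embed_mem_slice[OF j] intro!: borel_measurable_continuous_onI continuous_on_slice_embed)
qed

lemma slice_set_nn_integral:
  fixes g :: "quat \<Rightarrow> real"
  assumes j: "j \<in> imag_sphere" and g: "continuous_on quat_ball g"
  shows "(\<integral>\<^sup>+ r\<in>slice quat_ball j. ennreal (g r) \<partial>slice_measure j) =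
    (\<integral>\<^sup>+ z. ennreal (indicator (ball 0 1) z * g (slice_embed j z)) \<partial>lborel)"
proof -
  have "(\<lambda>r. indicator (slice quat_ball j) r * ennreal (indicator quat_ball r *\<^sub>R g r)) \<in> borel_measurable borel"
    using slice_ball_borel[OF j] by (intro borel_measurable_times_ennreal borel_measurable_indicator
        measurable_compose[OF _ measurable_ennreal] borel_measurable_continuous_on_indicator g) auto
  also have "(\<lambda>r. indicator (slice quat_ball j) r * ennreal (indicator quat_ball r *\<^sub>R g r)) =
      (\<lambda>r. ennreal (g r) * indicator (slice quat_ball j) r)"
    by (auto simp: indicator_def slice_def)
  finally show ?thesis
    unfolding slice_measure_eq_distr
    by (subst nn_integral_distr)
       (auto simp: indicator_def slice_embed_mem_slice[OF j]
         intro!: borel_measurable_continuous_onI continuous_on_slice_embed nn_integral_cong)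
qed

lemma continuous_on_slice_embed_compose:
  assumes "j \<in> imag_sphere" "continuous_on quat_ball f"
  shows "continuous_on (ball 0 1) (\<lambda>z. f (slice_embed j z))"
  using assms by (intro continuous_on_compose2[OF _ continuous_on_slice_embed]) (auto simp: norm_slice_embed)

lemma slice_regular_continuous: "slice_regular_on S f \<Longrightarrow> continuous_on S f"
  by (simp add: slice_regular_on_def differentiable_imp_continuous_on)

text \<open>On a set of finite area the bound t <= 1 + t^2 turns square integrability into the
  integrability that \<open>disc_bergman_reproducing\<close> asks for.\<close>

lemma slice_bergman_space_integrable:
  assumes f: "f \<in> slice_bergman_space quat_ball j" and j: "j \<in> imag_sphere"
  shows "set_integrable lborel (ball 0 1) (\<lambda>z. f (slice_embed j z))"
proof -
  have c: "continuous_on quat_ball f"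
    using f by (simp add: slice_bergman_space_def slice_regular_continuous)
  note cs = continuous_on_slice_embed_compose[OF j c]
  have L2: "(\<integral>\<^sup>+ z. ennreal (indicator (ball 0 1) z * (norm (f (slice_embed j z)))\<^sup>2) \<partial>lborel) < \<infinity>"
    using f unfolding slice_bergman_space_def
    by (subst slice_set_nn_integral[OF j, symmetric]) (auto intro!: continuous_intros c)
  have "integrable lborel (\<lambda>z. indicator (ball 0 1) z *\<^sub>R (norm (f (slice_embed j z)))\<^sup>2)"
  proof (rule integrableI_nonneg)
    show "(\<lambda>z. indicator (ball 0 1) z *\<^sub>R (norm (f (slice_embed j z)))\<^sup>2) \<in> borel_measurable lborel"
      using borel_measurable_continuous_on_indicator[OF _ continuous_on_power[OF continuous_on_norm[OF cs]]] by simp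
  qed (use L2 in auto)
  moreover have "integrable lborel (indicator (ball (0 :: complex) 1) :: _ \<Rightarrow> real)"
    using emeasure_lborel_ball_finite[of "0 :: complex" 1] by (simp add: integrable_indicator_iff)
  ultimately have "integrable lborel (\<lambda>z. indicator (ball 0 1) z + indicator (ball 0 1) z *\<^sub>R (norm (f (slice_embed j z)))\<^sup>2)"
    by (rule Bochner_Integration.integrable_add[rotated])
  then show ?thesis
    unfolding set_integrable_def
  proof (rule Bochner_Integration.integrable_bound)
    show "(\<lambda>z. indicator (ball 0 1) z *\<^sub>R f (slice_embed j z)) \<in> borel_measurable lborel"
      using borel_measurable_continuous_on_indicator[OF _ cs] by simp
    have "t \<le> 1 + t\<^sup>2" if "0 \<le> t" for t :: real
      using sum_squares_ge_zero[of "t - 1/2" 0] by (simp add: power2_eq_square algebra_simps)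
    then show "AE z in lborel. norm (indicator (ball 0 1) z *\<^sub>R f (slice_embed j z)) \<le>
        norm (indicator (ball 0 1) z + indicator (ball 0 1) z *\<^sub>R (norm (f (slice_embed j z)))\<^sup>2)"
      by (intro AE_I2) (auto simp: indicator_def)
  qed
qed

text \<open>Off the slice of \<open>q\<close>, the slice regular extension of the conjugate disc kernel in the second
  variable \<open>r\<close> is again \<open>ball_kernel\<close>, with the arguments exchanged.\<close>

definition ball_repr :: "quat \<Rightarrow> quat \<Rightarrow> quat" where
  "ball_repr q = restrict (\<lambda>r. ball_kernel r (qcnj q)) quat_ball"

lemma ball_repr_slice:
  assumes j: "j \<in> imag_sphere" and "norm z < 1" "norm w < 1"
  shows "ball_repr (slice_embed j w) (slice_embed j z) = slice_embed j (disc_kernel z (cnj w))"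
  using assms by (simp add: ball_repr_def norm_slice_embed qcnj_slice_embed ball_kernel_same_slice)

lemma ball_repr_in_space:
  assumes j: "j \<in> imag_sphere" and w: "norm w < 1"
  shows "ball_repr (slice_embed j w) \<in> slice_bergman_space quat_ball j"
proof -
  let ?f = "ball_repr (slice_embed j w)"
  have reg: "slice_regular_on quat_ball ?f"
    using w by (intro slice_regular_ball_kernel[OF j, of "cnj w"]) (auto simp: ball_repr_def qcnj_slice_embed[OF j])
  let ?B = "(1 / (pi * (1 - norm w)\<^sup>2))\<^sup>2"
  have "(\<integral>\<^sup>+ r\<in>slice quat_ball j. ennreal ((norm (?f r))\<^sup>2) \<partial>slice_measure j) =
    (\<integral>\<^sup>+ z. ennreal (indicator (ball 0 1) z * (norm (?f (slice_embed j z)))\<^sup>2) \<partial>lborel)"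
    by (intro slice_set_nn_integral j continuous_intros slice_regular_continuous reg)
  also have "\<dots> \<le> (\<integral>\<^sup>+ z. ennreal ?B * indicator (ball (0 :: complex) 1) z \<partial>lborel)"
  proof (intro nn_integral_mono)
    fix z :: complex
    show "ennreal (indicator (ball 0 1) z * (norm (?f (slice_embed j z)))\<^sup>2) \<le> ennreal ?B * indicator (ball 0 1) z"
    proof (cases "z \<in> ball 0 1")
      case True
      then have "(norm (?f (slice_embed j z)))\<^sup>2 \<le> ?B"
        using w norm_disc_kernel_le[of z "cnj w"]
        by (intro power_mono) (auto simp: ball_repr_slice[OF j _ w] norm_slice_embed[OF j])
      with True show ?thesis by (simp add: ennreal_leI)
    qed simp
  qed
  also have "\<dots> = ennreal ?B * emeasure lborel (ball (0 :: complex) 1)"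
    by (rule nn_integral_cmult_indicator) simp
  also have "\<dots> < \<infinity>"
    using emeasure_lborel_ball_finite[of "0 :: complex" 1] by (simp add: ennreal_mult_less_top)
  finally show ?thesis
    using reg by (simp add: slice_bergman_space_def ball_repr_def)
qed

text \<open>On the slice the conjugated kernel takes values in C(j) and stands to the left of f.
  Projecting after right multiplication by c therefore pulls it out as a complex factor, and the
  claim becomes the disc formula for the holomorphic function \<open>?F\<close>.\<close>

lemma ball_repr_reproducing:
  assumes j: "j \<in> imag_sphere" and w: "norm w < 1" and f: "f \<in> slice_bergman_space quat_ball j"
  shows "slice_bergman_inner quat_ball j (ball_repr (slice_embed j w)) f = f (slice_embed j w)"
proof (rule slice_proj_right_mult_eqD[of j])
  fix c
  let ?K = "ball_repr (slice_embed j w)"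
  let ?F = "\<lambda>z. slice_proj j (f (slice_embed j z) * c)"
  have f_reg: "slice_regular_on quat_ball f"
    using f by (simp add: slice_bergman_space_def)
  have K_reg: "slice_regular_on quat_ball ?K"
    using ball_repr_in_space[OF j w] by (simp add: slice_bergman_space_def)
  have cont: "continuous_on quat_ball (\<lambda>r. qcnj (?K r) * f r)"
    by (intro continuous_on_mult bounded_linear.continuous_on[OF bounded_linear_qcnj]
        slice_regular_continuous f_reg K_reg)
  have K: "qcnj (?K (slice_embed j z)) = slice_embed j (1 / of_real pi * (1 / (1 - w * cnj z)\<^sup>2))" if "norm z < 1" for z
    by (simp add: ball_repr_slice[OF j that w] qcnj_slice_embed[OF j] disc_kernel_def mult.commute)
  have f_int: "integrable lborel (\<lambda>z. indicator (ball 0 1) z *\<^sub>R f (slice_embed j z))"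
    using slice_bergman_space_integrable[OF f j] by (simp add: set_integrable_def)
  \<comment> \<open>Integrability of the quaternion-valued product is what allows the projection to
    pass under the integral.\<close>
  have int: "integrable lborel (\<lambda>z. indicator (ball 0 1) z *\<^sub>R (qcnj (?K (slice_embed j z)) * f (slice_embed j z)))"
  proof (rule Bochner_Integration.integrable_bound)
    show "integrable lborel (\<lambda>z. (1 / (pi * (1 - norm w)\<^sup>2)) * norm (indicator (ball 0 1) z *\<^sub>R f (slice_embed j z)))"
      by (intro integrable_mult_right integrable_norm f_int)
    show "(\<lambda>z. indicator (ball 0 1) z *\<^sub>R (qcnj (?K (slice_embed j z)) * f (slice_embed j z))) \<in> borel_measurable lborel"
      using borel_measurable_continuous_on_indicator[OF _ continuous_on_slice_embed_compose[OF j cont]] by simp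
    have "norm (qcnj (?K (slice_embed j z))) \<le> 1 / (pi * (1 - norm w)\<^sup>2)" if "norm z < 1" for z
      using that w norm_disc_kernel_le[of z "cnj w"]
      by (simp add: ball_repr_slice[OF j that w] qcnj_slice_embed[OF j] norm_slice_embed[OF j])
    then show "AE z in lborel. norm (indicator (ball 0 1) z *\<^sub>R (qcnj (?K (slice_embed j z)) * f (slice_embed j z))) \<le>
        norm ((1 / (pi * (1 - norm w)\<^sup>2)) * norm (indicator (ball 0 1) z *\<^sub>R f (slice_embed j z)))"
      by (intro AE_I2) (auto simp: indicator_def norm_mult simp del: times_divide_eq_left intro!: mult_right_mono)
  qed
  have lin: "bounded_linear (\<lambda>q. slice_proj j (q * c))"
    by (rule bounded_linear_compose[OF bounded_linear_slice_proj bounded_linear_mult_left])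
  have F_int: "set_integrable lborel (ball 0 1) ?F"
    using integrable_bounded_linear[OF lin f_int] linear_scale[OF bounded_linear.linear[OF lin]]
    by (simp add: set_integrable_def)
  have "slice_bergman_inner quat_ball j ?K f = (LINT z:ball 0 1|lborel. qcnj (?K (slice_embed j z)) * f (slice_embed j z))"
    unfolding slice_bergman_inner_def by (rule slice_set_integral[OF j cont])
  then have "slice_proj j (slice_bergman_inner quat_ball j ?K f * c) =
      (LINT z|lborel. slice_proj j (indicator (ball 0 1) z *\<^sub>R (qcnj (?K (slice_embed j z)) * f (slice_embed j z)) * c))"
    using integral_bounded_linear[OF lin int] by (simp add: set_lebesgue_integral_def)
  also have "\<dots> = (LINT z|lborel. 1 / of_real pi * (indicator (ball 0 1) z *\<^sub>R (?F z / (1 - w * cnj z)\<^sup>2)))"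
  proof (rule Bochner_Integration.integral_cong[OF refl])
    fix z
    show "slice_proj j (indicator (ball 0 1) z *\<^sub>R (qcnj (?K (slice_embed j z)) * f (slice_embed j z)) * c) =
        1 / of_real pi * (indicator (ball 0 1) z *\<^sub>R (?F z / (1 - w * cnj z)\<^sup>2))"
    proof (cases "norm z < 1")
      case True
      then show ?thesis
        using slice_proj_slice_embed_mult[OF j, of _ "f (slice_embed j z) * c"]
        by (simp add: K mult.assoc)
    next
      case False
      then show ?thesis using linear_0[OF bounded_linear.linear[OF bounded_linear_slice_proj[of j]]] by simp
    qed
  qed
  also have "\<dots> = 1 / of_real pi * (LINT z:ball 0 1|lborel. ?F z / (1 - w * cnj z)\<^sup>2)"
    by (simp only: set_lebesgue_integral_def integral_mult_right_zero)
  also have "\<dots> = ?F w"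
    by (subst disc_bergman_reproducing[OF slice_regular_proj_holomorphic[OF f_reg j] F_int w]) simp
  finally show "slice_proj j (slice_bergman_inner quat_ball j ?K f * c) = slice_proj j (f (slice_embed j w) * c)" .
qed

section \<open>Uniqueness of the representing element and identification of the kernels\<close>

lemma qcnj_mult: "qcnj (p * q) = qcnj q * qcnj p"
  by (simp add: quat_eq_iff algebra_simps)

lemma qcnj_qcnj [simp]: "qcnj (qcnj q) = q"
  by (simp add: quat_eq_iff)

text \<open>Conjugation is a bounded linear involution, so it commutes with the integral whether or
  not the integrand is integrable.\<close>

lemma slice_bergman_inner_commute:
  "slice_bergman_inner \<Omega> j g f = qcnj (slice_bergman_inner \<Omega> j f g)"
proof -
  have "qcnj (slice_bergman_inner \<Omega> j f g) =
      (LINT r|slice_measure j. qcnj (indicator (slice \<Omega> j) r *\<^sub>R (qcnj (f r) * g r)))"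
    unfolding slice_bergman_inner_def set_lebesgue_integral_def
    by (rule integral_bounded_linear'[OF bounded_linear_qcnj bounded_linear_qcnj, symmetric]) simp
  also have "\<dots> = slice_bergman_inner \<Omega> j g f"
    by (simp add: slice_bergman_inner_def set_lebesgue_integral_def qcnj_mult
        linear_scale[OF bounded_linear.linear[OF bounded_linear_qcnj]])
  finally show ?thesis by simp
qed

text \<open>Hermitian symmetry already determines a representing element on the slice; the identity
  principle does the rest.\<close>

lemma slice_bergman_repr_ball:
  assumes j: "j \<in> imag_sphere" and w: "norm w < 1"
  shows "slice_bergman_repr quat_ball j (slice_embed j w) = ball_repr (slice_embed j w)"
  unfolding slice_bergman_repr_def
proof (rule the_equality)
  show "ball_repr (slice_embed j w) \<in> slice_bergman_space quat_ball j \<and>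
     (\<forall>f\<in>slice_bergman_space quat_ball j. f (slice_embed j w) =
        slice_bergman_inner quat_ball j (ball_repr (slice_embed j w)) f)"
    using ball_repr_in_space[OF j w] ball_repr_reproducing[OF j w] by simp
next
  fix K assume K: "K \<in> slice_bergman_space quat_ball j \<and>
     (\<forall>f\<in>slice_bergman_space quat_ball j. f (slice_embed j w) = slice_bergman_inner quat_ball j K f)"
  \<comment> \<open>The value of \<open>H\<close> at z is its product with the element reproducing
    at z; exchanging the factors conjugates it, and the assumption on \<open>H\<close> evaluates the
    result at w. Applying this to \<open>K\<close> and to \<open>ball_repr\<close> itself shows that
    they agree on the slice.\<close>
  have sym: "H (slice_embed j z) = qcnj (ball_repr (slice_embed j z) (slice_embed j w))"
    if "H \<in> slice_bergman_space quat_ball j"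
      "\<forall>f\<in>slice_bergman_space quat_ball j. f (slice_embed j w) = slice_bergman_inner quat_ball j H f"
      and z: "norm z < 1" for H z
    using that ball_repr_reproducing[OF j z that(1)] ball_repr_in_space[OF j z]
      slice_bergman_inner_commute[of quat_ball j "ball_repr (slice_embed j z)" H] by simp
  have eq: "K (slice_embed j z) = ball_repr (slice_embed j w) (slice_embed j z)" if "norm z < 1" for z
    using sym[of K z] sym[of "ball_repr (slice_embed j w)" z] K that
      ball_repr_in_space[OF j w] ball_repr_reproducing[OF j w] by simp
  show "K = ball_repr (slice_embed j w)"
  proof
    fix q
    show "K q = ball_repr (slice_embed j w) q"
    proof (cases "q \<in> quat_ball")
      case True
      show ?thesis
      proof (rule slice_regular_eq_on_reals[OF _ _ _ True])
        show "K (of_real x) = ball_repr (slice_embed j w) (of_real x)" if "\<bar>x\<bar> < 1" for x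
          using eq[of "of_real x"] that by simp
      qed (use K ball_repr_in_space[OF j w] in \<open>auto simp: slice_bergman_space_def\<close>)
    next
      \<comment> \<open>Outside the ball both functions take the default value of extensional
        functions.\<close>
      case False
      then show ?thesis
        using K by (simp add: ball_repr_def slice_bergman_space_def extensional_arb[of K quat_ball])
    qed
  qed
qed

lemma cnj_disc_kernel: "cnj (disc_kernel z (cnj w)) = disc_kernel w (cnj z)"
  by (simp add: disc_kernel_def mult.commute)

lemma bergman_kernel_on_slice_ball:
  assumes j: "j \<in> imag_sphere" and "norm z < 1" "norm w < 1"
  shows "bergman_kernel_on_slice quat_ball j (slice_embed j z) (slice_embed j w) =
    slice_embed j (disc_kernel z (cnj w))"
  using assms by (simp add: bergman_kernel_on_slice_def slice_bergman_repr_ball ball_repr_slice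
      qcnj_slice_embed[OF j] cnj_disc_kernel)

lemma bergman_kernel_extension_ball:
  assumes i: "i \<in> imag_sphere" and j: "j \<in> imag_sphere"
    and q: "slice_point i x y \<in> quat_ball" and r: "r \<in> slice quat_ball j"
  shows "bergman_kernel_extension quat_ball j i x y r = ball_kernel (slice_point i x y) (qcnj r)"
proof -
  obtain w where w: "norm w < 1" "r = slice_embed j w"
    using r slice_ball_iff[OF j] by blast
  have z: "norm (Complex x y) < 1"
    using q by (simp add: slice_point_eq_slice_embed norm_slice_embed[OF i])
  have c: "Complex x (- y) = cnj (Complex x y)" by (simp add: complex_eq_iff)
  show ?thesis
    using z w by (simp add: bergman_kernel_extension_def slice_point_eq_slice_embed c
        bergman_kernel_on_slice_ball[OF j] qcnj_slice_embed[OF j] ball_kernel_slices[OF i j])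
qed

text \<open>The closed form mentions neither unit, so it satisfies the description for all choices
  at once; a single choice, which always exists, then forces the value.\<close>

lemma slice_bergman_kernel_ball:
  assumes q: "q \<in> quat_ball" and r: "r \<in> quat_ball"
  shows "slice_bergman_kernel quat_ball q r = ball_kernel q (qcnj r)"
  unfolding slice_bergman_kernel_def
proof (rule the_equality)
  show "\<forall>j\<in>imag_sphere. r \<in> slice quat_ball j \<longrightarrow>
     (\<forall>i\<in>imag_sphere. \<forall>x y. q = slice_point i x y \<longrightarrow>
        ball_kernel q (qcnj r) = bergman_kernel_extension quat_ball j i x y r)"
    using q by (auto simp: bergman_kernel_extension_ball)
next
  fix k assume k: "\<forall>j\<in>imag_sphere. r \<in> slice quat_ball j \<longrightarrow>
     (\<forall>i\<in>imag_sphere. \<forall>x y. q = slice_point i x y \<longrightarrow>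
        k = bergman_kernel_extension quat_ball j i x y r)"
  obtain j w where j: "j \<in> imag_sphere" and w: "r = slice_embed j w" by (rule slice_embed_surj)
  obtain i z where i: "i \<in> imag_sphere" and z: "q = slice_embed i z" by (rule slice_embed_surj)
  have "r \<in> slice quat_ball j"
    using r by (simp add: w slice_embed_mem_slice[OF j] norm_slice_embed[OF j])
  moreover have "q = slice_point i (Re z) (Im z)" by (simp add: z slice_embed_def)
  ultimately show "k = ball_kernel q (qcnj r)"
    using k i j q bergman_kernel_extension_ball[OF i j, of "Re z" "Im z" r] by metis
qed

lemma bergman_fueter_kernel_ball:
  assumes q: "q \<in> quat_ball" and r: "r \<in> quat_ball"
  shows "bergman_fueter_kernel q r = ball_fueter_kernel q (qcnj r)"
proof -
  obtain j w where j: "j \<in> imag_sphere" and w: "r = slice_embed j w" by (rule slice_embed_surj)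
  then have "norm (cnj w) < 1" using r by (simp add: norm_slice_embed)
  then have "qlaplacian (\<lambda>p. slice_bergman_kernel quat_ball p r) q = ball_fueter_kernel q (slice_embed j (cnj w))"
  proof (rule qlaplacian_ball_kernel[OF _ j q])
    show "slice_bergman_kernel quat_ball p r = ball_kernel p (slice_embed j (cnj w))" if "p \<in> quat_ball" for p
      using slice_bergman_kernel_ball[OF that r] by (simp add: w qcnj_slice_embed[OF j])
  qed
  then show ?thesis
    by (simp add: bergman_fueter_kernel_def w qcnj_slice_embed[OF j])
qed

section \<open>Anti-regularity in the second variable\<close>

lemma differentiable_inverse_div_algebra:
  fixes f :: "'a::real_normed_vector \<Rightarrow> 'b::real_normed_div_algebra"
  assumes "f differentiable (at x)" "f x \<noteq> 0"
  shows "(\<lambda>x. inverse (f x)) differentiable (at x)"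
proof -
  obtain D where "(f has_derivative D) (at x)"
    using assms(1) by (auto simp: differentiable_def)
  from Deriv.has_derivative_inverse[OF assms(2) this] show ?thesis
    by (rule differentiableI)
qed

lemma bergman_den_quat_nonzero:
  assumes "q \<in> quat_ball" "p \<in> quat_ball"
  shows "bergman_den (qRe q) ((norm q)\<^sup>2) p \<noteq> 0"
proof -
  obtain j w where j: "j \<in> imag_sphere" and w: "p = slice_embed j w" by (rule slice_embed_surj)
  have "norm w < 1" using assms(2) by (simp add: w norm_slice_embed[OF j])
  then show ?thesis
    using bergman_den_nonzero[OF assms(1)]
    by (simp add: w slice_embed_eq_0_iff[OF j] flip: slice_embed_bergman(1)[OF j])
qed

lemma differentiable_power_normed_algebra:
  fixes f :: "'a::real_normed_vector \<Rightarrow> 'b::real_normed_algebra_1"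
  assumes "f differentiable (at x)"
  shows "(\<lambda>x. f x ^ n) differentiable (at x)"
proof (induction n)
  case (Suc n)
  from differentiable_mult[OF assms Suc.IH] show ?case by simp
qed simp

text \<open>Real differentiability concerns all four directions of p, not only those of one slice,
  so the closed form is differentiated here with a quaternionic argument.\<close>

lemma ball_fueter_kernel_differentiable:
  assumes "q \<in> quat_ball" "p \<in> quat_ball"
  shows "(\<lambda>p. ball_fueter_kernel q p) differentiable (at p)"
proof -
  have "bergman_den (qRe q) ((norm q)\<^sup>2) differentiable (at p)"
    unfolding bergman_den_def[abs_def]
    by (intro differentiable_add differentiable_diff differentiable_const differentiable_scaleR
        differentiable_power_normed_algebra differentiable_ident)
  then have "(\<lambda>p. inverse (bergman_den (qRe q) ((norm q)\<^sup>2) p)) differentiable (at p)"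
    by (rule differentiable_inverse_div_algebra) (rule bergman_den_quat_nonzero[OF assms])
  then show ?thesis
    unfolding ball_fueter_kernel_def fueter_fst_def fueter_snd_def
    by (intro differentiable_add differentiable_mult differentiable_const differentiable_scaleR
        differentiable_diff differentiable_power_normed_algebra differentiable_ident)
qed

lemma fueter_field_differentiable:
  fixes w :: complex
  assumes "bergman_den x s w \<noteq> 0"
  shows "fueter_fst x s field_differentiable (at w)" "fueter_snd x s field_differentiable (at w)"
proof -
  have den: "bergman_den x s field_differentiable (at w)"
    unfolding bergman_den_def[abs_def] scaleR_conv_of_real by (intro derivative_intros)
  show "fueter_fst x s field_differentiable (at w)"
    unfolding fueter_fst_def[abs_def] scaleR_conv_of_real by (intro derivative_intros den assms)
  show "fueter_snd x s field_differentiable (at w)"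
    unfolding fueter_snd_def[abs_def] scaleR_conv_of_real by (intro derivative_intros den assms)
qed

text \<open>The factor conj(q) stands on the left, so right multiplication by i acts only on the
  embedded holomorphic coefficients. They are evaluated at the conjugate of the variable, which
  turns holomorphy into the anti-regular equation.\<close>

lemma slice_antiregular_ball_fueter_kernel:
  assumes q: "q \<in> quat_ball" and f: "\<And>r. r \<in> quat_ball \<Longrightarrow> f r = ball_fueter_kernel q (qcnj r)"
  shows "slice_antiregular_right_on quat_ball f"
  unfolding slice_antiregular_right_on_def
proof (intro conjI ballI allI impI)
  show "f differentiable_on quat_ball"
    unfolding differentiable_on_def
  proof
    fix r :: quat assume r: "r \<in> quat_ball"
    then have "qcnj r \<in> quat_ball" by (simp add: norm_quat_eq)
    from ball_fueter_kernel_differentiable[OF q this]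
    obtain D where D: "((\<lambda>p. ball_fueter_kernel q p) has_derivative D) (at (qcnj r))"
      by (auto simp: differentiable_def)
    have "((\<lambda>r. ball_fueter_kernel q (qcnj r)) has_derivative (\<lambda>h. D (qcnj h))) (at r)"
      by (rule has_derivative_compose[OF bounded_linear.has_derivative[OF bounded_linear_qcnj has_derivative_ident] D])
    then have "(f has_derivative (\<lambda>h. D (qcnj h))) (at r)"
      by (rule has_derivative_transform_within_open[OF _ open_ball r]) (simp add: f)
    then show "f differentiable at r within quat_ball"
      by (rule differentiable_at_withinI[OF differentiableI])
  qed
next
  fix i x y assume i: "i \<in> imag_sphere" and "slice_point i x y \<in> quat_ball"
  then have z: "norm (Complex x y) < 1"
    by (simp add: slice_point_eq_slice_embed norm_slice_embed)
  let ?g = "fueter_fst (qRe q) ((norm q)\<^sup>2) :: complex \<Rightarrow> complex"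
  let ?h = "fueter_snd (qRe q) ((norm q)\<^sup>2) :: complex \<Rightarrow> complex"
  have nz: "bergman_den (qRe q) ((norm q)\<^sup>2) (cnj (Complex x y)) \<noteq> 0"
    using z by (intro bergman_den_nonzero q) simp
  obtain g' h' where g': "(?g has_field_derivative g') (at (cnj (Complex x y)))"
      and h': "(?h has_field_derivative h') (at (cnj (Complex x y)))"
    using fueter_field_differentiable[OF nz] by (auto simp: field_differentiable_def)
  let ?D = "\<lambda>k. slice_embed i (g' * cnj k) + qcnj q * slice_embed i (h' * cnj k)"
  have D: "((\<lambda>z. slice_embed i (?g (cnj z)) + qcnj q * slice_embed i (?h (cnj z))) has_derivative ?D) (at (Complex x y))"
    by (intro has_derivative_add has_derivative_mult_right slice_embed_cnj_has_derivative g' h')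
  have F: "f (slice_embed i z) = slice_embed i (?g (cnj z)) + qcnj q * slice_embed i (?h (cnj z))" if "norm z < 1" for z
    using that by (subst f) (simp_all add: norm_slice_embed[OF i] qcnj_slice_embed[OF i] ball_fueter_kernel_def
        slice_embed_bergman[OF i])
  \<comment> \<open>The conjugate of the imaginary unit times the unit itself is 1.\<close>
  have "?D \<i> * i = ?D 1"
  proof -
    have "slice_embed i (c * cnj \<i>) * i = slice_embed i (c * cnj 1)" for c
      using slice_embed_mult[OF i, of "c * cnj \<i>" \<i>] by (simp add: mult.assoc)
    then show ?thesis by (simp only: distrib_right mult.assoc)
  qed
  then show "slice_dx f i x y - slice_dy f i x y * i = 0"
    using slice_partials[OF D z F] by simp
qed simp

theorem theorem6p4:
  shows "(\<forall>r\<in>quat_ball. fueter_regular_on quat_ball (\<lambda>q. bergman_fueter_kernel q r)) \<and>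
         (\<forall>q\<in>quat_ball. slice_antiregular_right_on quat_ball (\<lambda>r. bergman_fueter_kernel q r))"
proof (intro conjI ballI)
  fix r :: quat assume r: "r \<in> quat_ball"
  obtain j w where j: "j \<in> imag_sphere" and w: "r = slice_embed j w" by (rule slice_embed_surj)
  then have "norm (cnj w) < 1" using r by (simp add: norm_slice_embed)
  then show "fueter_regular_on quat_ball (\<lambda>q. bergman_fueter_kernel q r)"
  proof (rule fueter_regular_ball_fueter_kernel[OF _ j])
    show "bergman_fueter_kernel q r = ball_fueter_kernel q (slice_embed j (cnj w))" if "q \<in> quat_ball" for q
      using bergman_fueter_kernel_ball[OF that r] by (simp add: w qcnj_slice_embed[OF j])
  qed
next
  fix q :: quat assume q: "q \<in> quat_ball"
  then show "slice_antiregular_right_on quat_ball (\<lambda>r. bergman_fueter_kernel q r)"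
    by (rule slice_antiregular_ball_fueter_kernel) (rule bergman_fueter_kernel_ball[OF q])
qed

end
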